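(* Let $(X,T)$ be a dynamical system with the almost specification property. Then the restriction of $(X,T)$ to its measure center is topological K. If, moreover, the measure center is non-trivial (i.e. has more than one point), then $(X,T)$ has a horseshoe.
   Context: $\mathbb{N}=\{1,2,\ldots\}$, $\mathbb{Z}_+=\{0,1,\ldots\}$. A dynamical system $(X,T)$ is a compact metric space $(X,\rho)$ with a continuous map $T\colon X\to X$. Almost specification. A mistake function is a function $g\colon\mathbb{Z}_+\times(0,\varepsilon_0)\to\mathbb{N}$, for some $\varepsilon_0>0$, such that for all $\varepsilon<\varepsilon_0$ and $n\in\mathbb{Z}_+$ we have $g(n,\varepsilon)\le g(n+1,\varepsilon)$ and $\lim_{n\to\infty}g(n,\varepsilon)/n=0$. Let $k_g(\varepsilon)$ be the smallest $n\in\mathbb{N}$ such that $g(m,\varepsilon)<m\varepsilon$ for all $m\ge n$. For $n\ge k_g(\varepsilon)$ and $x\in X$ let $B_n(g;x,\varepsilon)$ be the set of all $y\in X$ for which there is $\Lambda\subset\{0,\ldots,n-1\}$ with $\#(\{0,\ldots,n-1\}\setminus\Lambda)\le g(n,\varepsilon)$ and $\rho(T^i(x),T^i(y))\le\varepsilon$ for all $i\in\Lambda$. $(X,T)$ has the almost specification property if there is a mistake function $g$ such that for all $m\ge1$, $\varepsilon_1,\ldots,\varepsilon_m\in(0,\varepsilon_0)$, $x_1,\ldots,x_m\in X$ and integers $0\le a_1\le b_1<a_2\le b_2<\ldots<a_m\le b_m$ with $n_j:=b_j-a_j+1\ge k_g(\varepsilon_j)$ for all $j$, there is $z\in X$ with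 $T^{a_j}(z)\in B_{n_j}(g;x_j,\varepsilon_j)$ for every $j=1,\ldots,m$. Measure center. An open set $U\subset X$ is universally null if $\mu(U)=0$ for every $T$-invariant Borel probability measure $\mu$. The measure center is the complement of the union of all universally null open sets; it is a closed $T$-invariant set. Entropy of covers. For a finite open cover $\mathcal{U}$, $N(\mathcal{U})$ is the least cardinality of a subcover, and $h(T,\mathcal{U})=\lim_{n\to\infty}\frac1n\log N\big(\bigvee_{i=0}^{n-1}T^{-i}\mathcal{U}\big)$. Topological K. An $n$-tuple $(x_1,\ldots,x_n)\in X^n$ is an entropy $n$-tuple if at least two of the points $x_j$ are different and, whenever closed mutually disjoint neighborhoods $U_j$ of the distinct points among $x_1,\ldots,x_n$ are chosen, the open cover consisting of the sets $X\setminus U_j$ satisfies $h(T,\{X\setminus U_j\})>0$. A system is topological K if, for every $n\ge2$, every non-diagonal $n$-tuple (i.e. one with at least two different entries) is an entropy tuple. Horseshoe. $(X,T)$ has a horseshoe if there are an integer $K>0$ and a closed set $Z\subset X$ with $T^K(Z)\subset Z$ such that the full shift over some finite alphabet with at least two symbols is a factor of $(Z,T^K|_Z)$, i.e. there is a continuous surjection from $Z$ onto the full shift intertwining $T^K|_Z$ with the shift map. *)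

theory Defs
  imports "HOL-Probability.Probability"
begin

text \<open>
  A dynamical system is a compact subset \<open>X\<close> of a metric space together with a map
  \<open>T\<close> of which only the restriction to \<open>X\<close> matters.  All topological notions are
  relative to \<open>X\<close>, so that restricting the system to an invariant subset \<open>Y\<close> just
  means replacing \<open>X\<close> by \<open>Y\<close>.
\<close>

definition dynamical_system :: "'a::metric_space set \<Rightarrow> ('a \<Rightarrow> 'a) \<Rightarrow> bool" where
  "dynamical_system X T \<longleftrightarrow> compact X \<and> continuous_on X T \<and> T ` X \<subseteq> X"


subsection \<open>Almost specification\<close>

text \<open>Mistake functions take positive integers as values, hence the bound \<open>1 \<le> g n \<epsilon>\<close>.\<close>

definition mistake_function :: "real \<Rightarrow> (nat \<Rightarrow> real \<Rightarrow> nat) \<Rightarrow> bool" where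
  "mistake_function \<epsilon>\<^sub>0 g \<longleftrightarrow> 0 < \<epsilon>\<^sub>0 \<and>
     (\<forall>\<epsilon>. 0 < \<epsilon> \<and> \<epsilon> < \<epsilon>\<^sub>0 \<longrightarrow>
        (\<forall>n. 1 \<le> g n \<epsilon> \<and> g n \<epsilon> \<le> g (n + 1) \<epsilon>) \<and>
        (\<lambda>n. real (g n \<epsilon>) / real n) \<longlonglongrightarrow> 0)"

definition mistake_threshold :: "(nat \<Rightarrow> real \<Rightarrow> nat) \<Rightarrow> real \<Rightarrow> nat" where
  "mistake_threshold g \<epsilon> = (LEAST n. 1 \<le> n \<and> (\<forall>m\<ge>n. real (g m \<epsilon>) < real m * \<epsilon>))"

definition mistake_ball ::
    "'a::metric_space set \<Rightarrow> ('a \<Rightarrow> 'a) \<Rightarrow> (nat \<Rightarrow> real \<Rightarrow> nat) \<Rightarrow> nat \<Rightarrow> 'a \<Rightarrow> real \<Rightarrow> 'a set" where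
  "mistake_ball X T g n x \<epsilon> =
     {y \<in> X. \<exists>\<Lambda>\<subseteq>{..<n}. card ({..<n} - \<Lambda>) \<le> g n \<epsilon> \<and>
                (\<forall>i\<in>\<Lambda>. dist ((T ^^ i) x) ((T ^^ i) y) \<le> \<epsilon>)}"

definition almost_specification :: "'a::metric_space set \<Rightarrow> ('a \<Rightarrow> 'a) \<Rightarrow> bool" where
  "almost_specification X T \<longleftrightarrow>
     (\<exists>\<epsilon>\<^sub>0 g. mistake_function \<epsilon>\<^sub>0 g \<and>
        (\<forall>m (\<epsilon> :: nat \<Rightarrow> real) (x :: nat \<Rightarrow> 'a) (a :: nat \<Rightarrow> nat) (b :: nat \<Rightarrow> nat).
           1 \<le> m \<and>
           (\<forall>j\<in>{1..m}. 0 < \<epsilon> j \<and> \<epsilon> j < \<epsilon>\<^sub>0 \<and> x j \<in> X \<and> a j \<le> b j \<and>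
                       mistake_threshold g (\<epsilon> j) \<le> b j - a j + 1) \<and>
           (\<forall>j\<in>{1..<m}. b j < a (j + 1))
           \<longrightarrow> (\<exists>z\<in>X. \<forall>j\<in>{1..m}.
                  (T ^^ a j) z \<in> mistake_ball X T g (b j - a j + 1) (x j) (\<epsilon> j))))"


subsection \<open>Measure center\<close>

definition invariant_prob :: "'a::metric_space set \<Rightarrow> ('a \<Rightarrow> 'a) \<Rightarrow> 'a measure \<Rightarrow> bool" where
  "invariant_prob X T \<mu> \<longleftrightarrow>
     prob_space \<mu> \<and> sets \<mu> = sets (restrict_space borel X) \<and>
     T \<in> \<mu> \<rightarrow>\<^sub>M \<mu> \<and> distr \<mu> \<mu> T = \<mu>"

definition universally_null :: "'a::metric_space set \<Rightarrow> ('a \<Rightarrow> 'a) \<Rightarrow> 'a set \<Rightarrow> bool" where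
  "universally_null X T U \<longleftrightarrow> (\<forall>\<mu>. invariant_prob X T \<mu> \<longrightarrow> emeasure \<mu> U = 0)"

definition measure_center :: "'a::metric_space set \<Rightarrow> ('a \<Rightarrow> 'a) \<Rightarrow> 'a set" where
  "measure_center X T =
     X - \<Union>{U. openin (top_of_set X) U \<and> universally_null X T U}"


subsection \<open>Entropy of covers and topological K systems\<close>

definition min_subcover :: "'a set \<Rightarrow> 'a set set \<Rightarrow> nat" where
  "min_subcover X \<U> = (LEAST k. \<exists>\<V>\<subseteq>\<U>. finite \<V> \<and> X \<subseteq> \<Union>\<V> \<and> card \<V> = k)"

text \<open>
  The join of the covers \<open>T\<^sup>-\<^sup>i \<U>\<close> for \<open>i < n\<close>: its members are the sets
  of the points of \<open>X\<close> whose first \<open>n\<close> iterates follow a given \<open>n\<close>-tuple \<open>A\<close> of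
  members of \<open>\<U>\<close>.
\<close>

definition iterated_join :: "'a set \<Rightarrow> ('a \<Rightarrow> 'a) \<Rightarrow> nat \<Rightarrow> 'a set set \<Rightarrow> 'a set set" where
  "iterated_join X T n \<U> =
     {{x \<in> X. \<forall>i<n. (T ^^ i) x \<in> A i} | A. A \<in> {..<n} \<rightarrow> \<U>}"

definition cover_entropy :: "'a set \<Rightarrow> ('a \<Rightarrow> 'a) \<Rightarrow> 'a set set \<Rightarrow> real" where
  "cover_entropy X T \<U> =
     lim (\<lambda>n. ln (real (min_subcover X (iterated_join X T n \<U>))) / real n)"

text \<open>An \<open>n\<close>-tuple is a list of length \<open>n\<close>; it is non-diagonal if two of its entries differ.\<close>

definition nondiagonal :: "'a list \<Rightarrow> bool" where
  "nondiagonal xs \<longleftrightarrow> (\<exists>p\<in>set xs. \<exists>q\<in>set xs. p \<noteq> q)"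

text \<open>
  The neighborhoods are indexed by the points of \<open>set xs\<close>, so that repeated entries
  of the tuple get one common neighborhood.
\<close>

definition entropy_tuple :: "'a::metric_space set \<Rightarrow> ('a \<Rightarrow> 'a) \<Rightarrow> nat \<Rightarrow> 'a list \<Rightarrow> bool" where
  "entropy_tuple X T n xs \<longleftrightarrow>
     length xs = n \<and> set xs \<subseteq> X \<and> nondiagonal xs \<and>
     (\<forall>U :: 'a \<Rightarrow> 'a set.
        (\<forall>p\<in>set xs. closedin (top_of_set X) (U p) \<and> p \<in> top_of_set X interior_of U p) \<and>
        (\<forall>p\<in>set xs. \<forall>q\<in>set xs. p \<noteq> q \<longrightarrow> U p \<inter> U q = {})
        \<longrightarrow> 0 < cover_entropy X T ((\<lambda>p. X - U p) ` set xs))"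

definition topological_K :: "'a::metric_space set \<Rightarrow> ('a \<Rightarrow> 'a) \<Rightarrow> bool" where
  "topological_K X T \<longleftrightarrow>
     (\<forall>n\<ge>2. \<forall>xs. length xs = n \<and> set xs \<subseteq> X \<and> nondiagonal xs \<longrightarrow> entropy_tuple X T n xs)"


subsection \<open>Horseshoes\<close>

definition factor_map ::
    "'a topology \<Rightarrow> ('a \<Rightarrow> 'a) \<Rightarrow> 'b topology \<Rightarrow> ('b \<Rightarrow> 'b) \<Rightarrow> ('a \<Rightarrow> 'b) \<Rightarrow> bool" where
  "factor_map X f Y g \<phi> \<longleftrightarrow>
     continuous_map X Y \<phi> \<and> \<phi> ` topspace X = topspace Y \<and>
     (\<forall>x\<in>topspace X. \<phi> (f x) = g (\<phi> x))"

text \<open>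
  The one-sided full shift over \<open>A\<close>.  (The two-sided full shift is never a factor of
  a one-sided one, although the latter is a prototypical horseshoe.)
\<close>

definition full_shift :: "'b set \<Rightarrow> (nat \<Rightarrow> 'b) topology" where
  "full_shift A = product_topology (\<lambda>_. discrete_topology A) UNIV"

definition shift :: "(nat \<Rightarrow> 'b) \<Rightarrow> nat \<Rightarrow> 'b" where
  "shift w = (\<lambda>i. w (Suc i))"

text \<open>Every finite alphabet may be taken to consist of natural numbers.\<close>

definition has_horseshoe :: "'a::metric_space set \<Rightarrow> ('a \<Rightarrow> 'a) \<Rightarrow> bool" where
  "has_horseshoe X T \<longleftrightarrow>
     (\<exists>K>0. \<exists>Z. closedin (top_of_set X) Z \<and> (T ^^ K) ` Z \<subseteq> Z \<and>
        (\<exists>A :: nat set. finite A \<and> 2 \<le> card A \<and>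
           (\<exists>\<phi>. factor_map (top_of_set Z) (T ^^ K) (full_shift A) shift \<phi>)))"

end

theory Submission
  imports Defs
begin

text \<open>
  Every neighborhood of a point of the measure center is charged by an invariant measure, so
  integrating visit counts yields, for finitely many points \<open>p\<close> of the center, orbit segments of
  length \<open>n\<close> that visit the neighborhoods of the respective \<open>p\<close> at the same set \<open>S\<close> of times,
  where \<open>S\<close> has density at least some \<open>c > 0\<close> not depending on \<open>n\<close>.  Almost
  specification concatenates these segments in any order at the cost of few mistakes compared to
  \<open>card S\<close>; let \<open>B p\<close> be the closed set of points whose first \<open>n\<close> iterates follow the
  segment of \<open>p\<close> in this sense.

  For two points, \<open>B p\<close> and \<open>B q\<close> are disjoint, and reading off the itinerary in
  \<open>B p \<union> B q\<close> along multiples of \<open>n\<close> maps a closed \<open>T\<^sup>n\<close>-invariant set onto the full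
  2-shift.

  For a tuple with \<open>k\<close> distinct entries, a member of the join of length \<open>m n\<close> prescribes at
  each time a neighborhood to be avoided.  In each block some \<open>p\<close> is prescribed at \<open>card S / k\<close>
  times of \<open>S\<close> or more, which excludes the letter \<open>p\<close> there.  So the member contains points for
  at most \<open>(k - 1)\<^sup>m\<close> of the \<open>k\<^sup>m\<close> words, and the entropy is at least \<open>ln (k / (k - 1)) / n\<close>.  That
  the points following the words can be taken in the measure center is seen by repeating a word and
  applying the Krylov-Bogoliubov argument.
\<close>

section \<open>Outer measures from finitely additive contents\<close>

text \<open>By Tychonoff the functions into [0,1] form a compact space, so the sequence has a
  cluster point. A filter finer than \<open>sequentially\<close> replaces a subsequence because the
  index type may be uncountable: later \<open>b\<close> runs through all sets of points.\<close>

lemma pointwise_cluster: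
  fixes f :: "nat \<Rightarrow> 'b \<Rightarrow> real"
  assumes "\<And>n b. f n b \<in> {0..1}"
  obtains G L where "G \<noteq> bot" "G \<le> sequentially" "\<And>b. ((\<lambda>n. f n b) \<longlongrightarrow> L b) G"
proof -
  let ?K = "PiE UNIV (\<lambda>_::'b. {0..1::real})"
  have "compactin (product_topology (\<lambda>_. euclidean) UNIV) ?K"
    by (subst compactin_PiE) auto
  then have "compact ?K"
    by (simp add: euclidean_product_topology)
  moreover have "eventually (\<lambda>x. x \<in> ?K) (filtermap f sequentially)"
    using assms by (auto simp: eventually_filtermap PiE_def Pi_def intro!: always_eventually)
  ultimately obtain L where L: "inf (nhds L) (filtermap f sequentially) \<noteq> bot"
    unfolding compact_filter by (metis filtermap_bot_iff trivial_limit_sequentially)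
  \<comment> \<open>Pulling the neighborhoods of \<open>L\<close> back along \<open>f\<close> forces
    convergence in every coordinate at once; being below \<open>sequentially\<close> keeps the
    indices tending to infinity.\<close>
  define G where "G = inf (filtercomap f (nhds L)) sequentially"
  have "G \<noteq> bot"
  proof
    assume "G = bot"
    then have "eventually (\<lambda>_. False) G" by simp
    then obtain R Q where R: "eventually R (nhds L)" and Q: "eventually Q sequentially"
      and RQ: "\<And>n. R (f n) \<Longrightarrow> Q n \<Longrightarrow> False"
      unfolding G_def eventually_inf eventually_filtercomap by metis
    \<comment> \<open>If \<open>G\<close> were trivial, \<open>f n\<close> would eventually violate
      \<open>R\<close>, which holds near \<open>L\<close>, so \<open>L\<close> would not be a
      cluster point.\<close>
    have "eventually (\<lambda>_. False) (inf (nhds L) (filtermap f sequentially))"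
      unfolding eventually_inf eventually_filtermap
    proof (rule exI[of _ R], rule exI[of _ "\<lambda>y. \<not> R y"], intro conjI allI impI)
      show "\<forall>\<^sub>F n in sequentially. \<not> R (f n)"
        using Q by eventually_elim (use RQ in blast)
    qed (use R in auto)
    with L show False by (simp add: trivial_limit_def)
  qed
  moreover have "G \<le> sequentially" by (simp add: G_def)
  moreover have "((\<lambda>n. f n b) \<longlongrightarrow> L b) G" for b
  proof -
    have "(f \<longlongrightarrow> L) G"
      unfolding G_def by (rule filterlim_mono[OF filterlim_filtercomap]) auto
    then show ?thesis
      by (rule continuous_on_tendsto_compose[OF continuous_on_product_coordinates]) auto
  qed
  ultimately show ?thesis using that by blast
qed

text \<open>Orbit frequencies and their limits make sense for arbitrary sets, so the content is
  defined on all of them and additivity involves no measurability. Being real-valued, it is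
  finite.\<close>

locale content =
  fixes lam :: "'a::metric_space set \<Rightarrow> real"
  assumes nonneg: "0 \<le> lam A"
    and additive: "A \<inter> B = {} \<Longrightarrow> lam (A \<union> B) = lam A + lam B"
begin

lemma empty [simp]: "lam {} = 0"
  using additive[of "{}" "{}"] by simp

lemma mono: "A \<subseteq> B \<Longrightarrow> lam A \<le> lam B"
  using additive[of A "B - A"] nonneg[of "B - A"] by (simp add: Un_absorb1)

lemma subadditive: "lam (A \<union> B) \<le> lam A + lam B"
  using additive[of A "B - A"] mono[of "B - A" B] by auto

lemma finite_subadditive: "finite I \<Longrightarrow> lam (\<Union>i\<in>I. U i) \<le> (\<Sum>i\<in>I. lam (U i))"
proof (induction I rule: finite_induct)
  case (insert i I)
  then show ?case using subadditive[of "U i" "\<Union>i\<in>I. U i"] by simp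
qed simp

text \<open>Partial sums are contents of finite disjoint unions, hence bounded by the finite number
  \<open>lam UNIV\<close>.\<close>

lemma summable_disjoint:
  assumes "\<And>i j. i < j \<Longrightarrow> D i \<inter> D j = {}"
  shows "summable (\<lambda>k::nat. lam (D k))"
proof (rule summableI_nonneg_bounded[OF nonneg])
  fix n
  have "(\<Sum>k<n. lam (D k)) = lam (\<Union>k<n. D k)"
  proof (induction n)
    case (Suc n)
    have "(\<Union>k<n. D k) \<inter> D n = {}" using assms by auto
    then show ?case using Suc additive[of "\<Union>k<n. D k" "D n"]
      by (simp add: lessThan_Suc Un_commute)
  qed simp
  then show "(\<Sum>k<n. lam (D k)) \<le> lam UNIV" by (simp add: mono)
qed

definition outer :: "'a set \<Rightarrow> ennreal" where
  "outer A = (INF U\<in>{U::nat \<Rightarrow> 'a set. (\<forall>i. open (U i)) \<and> A \<subseteq> (\<Union>i. U i)}. \<Sum>i. ennreal (lam (U i)))"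

lemma outer_le: "(\<And>i. open (U i)) \<Longrightarrow> A \<subseteq> (\<Union>i::nat. U i) \<Longrightarrow> outer A \<le> (\<Sum>i. ennreal (lam (U i)))"
  unfolding outer_def by (rule INF_lower) auto

lemma outer_greatest:
  assumes "\<And>U. (\<And>i::nat. open (U i)) \<Longrightarrow> A \<subseteq> (\<Union>i. U i) \<Longrightarrow> y \<le> (\<Sum>i. ennreal (lam (U i)))"
  shows "y \<le> outer A"
  unfolding outer_def using assms by (intro INF_greatest) auto

lemma outer_close:
  "outer A < e \<Longrightarrow> \<exists>U. (\<forall>i::nat. open (U i)) \<and> A \<subseteq> (\<Union>i. U i) \<and> (\<Sum>i. ennreal (lam (U i))) < e"
  unfolding outer_def INF_less_iff by auto

lemma outer_mono: "A \<subseteq> B \<Longrightarrow> outer A \<le> outer B"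
  by (rule outer_greatest) (rule outer_le, auto)

lemma outer_open_le: "open U \<Longrightarrow> outer U \<le> ennreal (lam U)"
proof -
  assume "open U"
  then have "outer U \<le> (\<Sum>i::nat. ennreal (lam (if i = 0 then U else {})))"
    by (intro outer_le) (auto split: if_splits)
  also have "\<dots> = (\<Sum>i\<in>{0::nat}. ennreal (lam (if i = 0 then U else {})))"
    by (rule suminf_finite) auto
  finally show ?thesis by simp
qed

lemma outer_empty [simp]: "outer {} = 0"
  using outer_open_le[of "{}"] by simp

lemma outer_countably_subadditive: "outer (\<Union>i. A i) \<le> (\<Sum>i::nat. outer (A i))"
proof (rule ennreal_le_epsilon)
  fix e :: real assume e: "0 < e" and fin: "(\<Sum>n. outer (A n)) < top"
  have "\<exists>U. (\<forall>i. open (U i)) \<and> A n \<subseteq> (\<Union>i::nat. U i) \<and>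
      (\<Sum>i. ennreal (lam (U i))) < outer (A n) + e * (1/2)^Suc n" for n
  proof -
    have "outer (A n) < outer (A n) + e * (1/2)^Suc n"
      using e fin by (auto simp add: less_top dest!: ennreal_suminf_lessD)
    then show ?thesis by (rule outer_close)
  qed
  then obtain B where B: "\<And>n i. open (B n i)" "\<And>n. A n \<subseteq> (\<Union>i::nat. B n i)"
    "\<And>n. (\<Sum>i. ennreal (lam (B n i))) < outer (A n) + e * (1/2)^Suc n"
    by metis
  define C where "C = case_prod B o prod_decode"
  have "(\<Union>i. A i) \<subseteq> (\<Union>i. C i)"
    using B(2) by (auto simp: C_def subset_eq) (metis prod.case prod_encode_inverse)
  moreover have "open (C i)" for i by (auto simp: C_def B(1) split: prod.splits)
  ultimately have "outer (\<Union>i. A i) \<le> (\<Sum>i. ennreal (lam (C i)))"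
    by (rule outer_le[rotated])
  also have "\<dots> = (\<Sum>n. \<Sum>i. ennreal (lam (B n i)))"
    unfolding C_def comp_def by (intro suminf_ennreal_2dimen) auto
  also have "\<dots> \<le> (\<Sum>n. outer (A n) + e * (1/2) ^ Suc n)"
    using B(3) by (intro suminf_le less_imp_le) auto
  also have "\<dots> = (\<Sum>n. outer (A n)) + (\<Sum>n. ennreal e * ennreal ((1/2) ^ Suc n))"
    using e by (subst suminf_add[symmetric])
      (auto simp del: ennreal_suminf_cmult simp add: ennreal_mult[symmetric])
  also have "\<dots> = (\<Sum>n. outer (A n)) + e"
    unfolding ennreal_suminf_cmult
    by (subst suminf_ennreal_eq[OF zero_le_power power_half_series]) auto
  finally show "outer (\<Union>i. A i) \<le> (\<Sum>i. outer (A i)) + e" .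
qed

lemma outer_subadditive: "outer (A \<union> B) \<le> outer A + outer B"
proof -
  have "A \<union> B = (\<Union>i::nat. if i = 0 then A else if i = 1 then B else {})" by (auto split: if_splits)
  also have "outer \<dots> \<le> (\<Sum>i::nat. outer (if i = 0 then A else if i = 1 then B else {}))"
    by (rule outer_countably_subadditive)
  also have "\<dots> = outer A + outer B"
    by (subst suminf_finite[of "{0,1}"]) auto
  finally show ?thesis .
qed

text \<open>Compactness cuts a countable open cover down to a finite one, to which finite
  subadditivity of \<open>lam\<close> applies. This is how mass survives the passage to
  \<open>outer\<close>.\<close>

lemma outer_compact_ge:
  assumes "compact C"
  shows "ennreal (lam C) \<le> outer C"
proof (rule outer_greatest)
  fix U :: "nat \<Rightarrow> 'a set" assume U: "\<And>i. open (U i)" "C \<subseteq> (\<Union>i. U i)"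
  obtain I where I: "finite I" "C \<subseteq> (\<Union>i\<in>I. U i)"
    using compactE_image[OF assms, of UNIV U] U by auto
  have "ennreal (lam C) \<le> ennreal (\<Sum>i\<in>I. lam (U i))"
    using mono[OF I(2)] finite_subadditive[OF I(1), of U] by (auto intro!: ennreal_leI)
  also have "\<dots> = (\<Sum>i\<in>I. ennreal (lam (U i)))" by (simp add: sum_ennreal nonneg)
  also have "\<dots> \<le> (\<Sum>i. ennreal (lam (U i)))" by (rule sum_le_suminf) (auto simp: I)
  finally show "ennreal (lam C) \<le> (\<Sum>i. ennreal (lam (U i)))" .
qed

text \<open>The content of the part of \<open>W\<close> near its boundary is small: the even and the odd
  members of the sequence of annuli \<open>k < 1 / infdist x (- W) < k + 2\<close> are disjoint families.\<close>

lemma open_inner_approx: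
  assumes "open W" and "0 < e"
  obtains G H where "G \<subseteq> H" "H \<subseteq> W" "closed H" "outer W \<le> ennreal (lam G) + ennreal e"
proof (cases "W = UNIV")
  case True
  then show ?thesis using that[of UNIV UNIV] outer_open_le[of UNIV] by (simp add: add_increasing2)
next
  case False
  define F where "F = - W"
  define d where "d x = 1 / infdist x F" for x
  have F: "closed F" "F \<noteq> {}" using assms False by (auto simp: F_def)
  have pos: "infdist x F > 0" if "x \<in> W" for x
    using that F in_closed_iff_infdist_zero[OF F, of x] infdist_nonneg[of x F]
    by (auto simp: F_def less_le)
  have cont: "continuous_on W d"
    unfolding d_def using pos by (intro continuous_intros) force
  have op: "open {x\<in>W. d x \<in> S}" if "open S" for S
  proof -
    have "open (d -` S \<inter> W)" using cont continuous_on_open_vimage[OF assms(1)] that by blast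
    then show ?thesis by (simp add: vimage_def Int_def conj_commute)
  qed
  \<comment> \<open>The annuli have width 2 so that consecutive ones overlap: being open, annuli of
    width 1 would miss the integer values of \<open>d\<close>. Those with even index are disjoint,
    and so are those with odd index.\<close>
  define R where "R k = {x\<in>W. d x \<in> {real k<..<real k + 2}}" for k
  define q where "q k = lam (R (2*k)) + lam (R (2*k+1))" for k
  have "summable (\<lambda>k. lam (R (2*k)))"
    by (rule summable_disjoint) (auto simp: R_def)
  moreover have "summable (\<lambda>k. lam (R (2*k+1)))"
    by (rule summable_disjoint) (auto simp: R_def)
  ultimately have sq: "summable q"
    unfolding q_def by (rule summable_add)
  obtain N where N: "norm (\<Sum>i. q (i + n)) < e" if "n \<ge> N" for n
    using suminf_exist_split[OF assms(2) sq] by metis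
  define Q where "Q k = R (2 * k) \<union> R (2*k+1)" for k
  have opQ: "open (Q k)" for k
    unfolding Q_def R_def by (intro open_Un op) auto
  have lQ: "lam (Q k) \<le> q k" for k
    unfolding Q_def q_def by (rule subadditive)
  \<comment> \<open>The closed set \<open>H\<close> is squeezed between the open set
    \<open>G\<close> and \<open>W\<close>. Points of \<open>W\<close> outside \<open>G\<close> lie
    in annuli of index at least \<open>2 * N\<close>, whose contents sum to less than
    \<open>e\<close>.\<close>
  define G where "G = {x\<in>W. d x < 2 * N + 1}"
  define H where "H = {x. infdist x F \<ge> 1 / (2 * N + 1)}"
  have "G \<subseteq> H"
    using pos by (auto simp: G_def H_def d_def field_simps)
  moreover have "H \<subseteq> W"
  proof
    fix x assume "x \<in> H"
    have "0 < 1 / real (2 * N + 1)" by simp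
    also have "\<dots> \<le> infdist x F" using \<open>x \<in> H\<close> by (simp add: H_def)
    finally have "infdist x F > 0" .
    then have "x \<notin> F" by force
    then show "x \<in> W" by (simp add: F_def)
  qed
  moreover have "closed H"
    unfolding H_def by (intro closed_Collect_le continuous_intros)
  moreover have "outer W \<le> ennreal (lam G) + ennreal e"
  proof -
    have "W \<subseteq> G \<union> (\<Union>k. Q (k + N))"
    proof
      fix x assume x: "x \<in> W"
      show "x \<in> G \<union> (\<Union>k. Q (k + N))"
      proof (cases "d x < 2 * N + 1")
        case False
        define j where "j = nat (ceiling (d x) - 1)"
        have d1: "d x \<ge> 2 * real N + 1" using False by simp
        then have j: "real j < d x" "d x \<le> real j + 1"
          unfolding j_def by linarith+
        then have "j \<ge> 2 * N" using d1 by linarith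
        have xR: "x \<in> R j" using x j by (simp add: R_def)
        have "x \<in> Q (j div 2)"
        proof (cases "even j")
          case True then show ?thesis using xR by (auto simp: Q_def)
        next
          case False then show ?thesis using xR by (auto simp: Q_def)
        qed
        moreover have "j div 2 \<ge> N" using \<open>j \<ge> 2 * N\<close> by linarith
        ultimately show ?thesis by (metis UN_I UNIV_I UnI2 le_add_diff_inverse2)
      qed (simp add: G_def x)
    qed
    then have "outer W \<le> outer (G \<union> (\<Union>k. Q (k + N)))" by (rule outer_mono)
    also have "\<dots> \<le> outer G + outer (\<Union>k. Q (k + N))" by (rule outer_subadditive)
    also have "\<dots> \<le> ennreal (lam G) + (\<Sum>k. ennreal (lam (Q (k + N))))"
    proof (rule add_mono)
      have "open {x\<in>W. d x \<in> {..<2 * N + 1}}" by (rule op) auto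
      then show "outer G \<le> ennreal (lam G)" by (intro outer_open_le) (simp add: G_def)
      show "outer (\<Union>k. Q (k + N)) \<le> (\<Sum>k. ennreal (lam (Q (k + N))))"
        by (rule outer_le) (auto simp: opQ)
    qed
    also have "(\<Sum>k. ennreal (lam (Q (k + N)))) \<le> (\<Sum>k. ennreal (q (k + N)))"
      by (intro suminf_le ennreal_leI lQ) auto
    also have "\<dots> = ennreal (\<Sum>k. q (k + N))"
      by (intro suminf_ennreal2 summable_ignore_initial_segment sq) (simp add: q_def nonneg)
    also have "\<dots> \<le> ennreal e" using N[of N] by (intro ennreal_leI) auto
    finally show ?thesis by (simp add: add_left_mono)
  qed
  ultimately show ?thesis using that by blast
qed

text \<open>Caratheodory's criterion is first tested on open \<open>V\<close>. Approximating
  \<open>V \<inter> U\<close> from inside gives a closed \<open>H\<close> for which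
  \<open>V - H\<close> is open, contains \<open>V - U\<close> and is disjoint from \<open>G\<close>,
  so that additivity of \<open>lam\<close> on \<open>G\<close> and \<open>V - H\<close> suffices.
  Open covers carry this over to arbitrary sets.\<close>

lemma open_in_lambda_system:
  assumes U: "open U"
  shows "U \<in> lambda_system UNIV (Pow UNIV) outer"
proof -
  have V: "outer (V \<inter> U) + outer (V - U) \<le> ennreal (lam V)" if "open V" for V
  proof (rule ennreal_le_epsilon)
    fix e :: real assume e: "0 < e"
    obtain G H where GH: "G \<subseteq> H" "H \<subseteq> V \<inter> U" "closed H" "outer (V \<inter> U) \<le> ennreal (lam G) + ennreal e"
      by (rule open_inner_approx[OF _ e, of "V \<inter> U"]) (use U \<open>open V\<close> e in auto)
    have "outer (V - U) \<le> outer (V - H)" using GH by (intro outer_mono) auto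
    also have "\<dots> \<le> ennreal (lam (V - H))" using GH that by (intro outer_open_le) auto
    finally have "outer (V \<inter> U) + outer (V - U) \<le> ennreal (lam G) + ennreal e + ennreal (lam (V - H))"
      using GH(4) by (rule add_mono[rotated])
    also have "\<dots> = ennreal (lam (G \<union> (V - H))) + ennreal e"
      using GH by (subst additive) (auto simp: ennreal_plus nonneg ac_simps)
    also have "\<dots> \<le> ennreal (lam V) + ennreal e"
      using GH by (intro add_right_mono ennreal_leI mono) auto
    finally show "outer (V \<inter> U) + outer (V - U) \<le> ennreal (lam V) + ennreal e" .
  qed
  have "outer (U \<inter> A) + outer ((UNIV - U) \<inter> A) = outer A" for A
  proof (rule antisym)
    show "outer (U \<inter> A) + outer ((UNIV - U) \<inter> A) \<le> outer A"
    proof (rule outer_greatest)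
      fix B :: "nat \<Rightarrow> 'a set" assume B: "\<And>i. open (B i)" "A \<subseteq> (\<Union>i. B i)"
      have "outer (U \<inter> A) \<le> outer (\<Union>i. B i \<inter> U)" using B by (intro outer_mono) auto
      moreover have "outer ((UNIV - U) \<inter> A) \<le> outer (\<Union>i. B i - U)"
        using B by (intro outer_mono) auto
      ultimately have "outer (U \<inter> A) + outer ((UNIV - U) \<inter> A)
          \<le> (\<Sum>i. outer (B i \<inter> U)) + (\<Sum>i. outer (B i - U))"
        by (intro add_mono) (erule order_trans, rule outer_countably_subadditive)+
      also have "\<dots> = (\<Sum>i. outer (B i \<inter> U) + outer (B i - U))"
        by (rule suminf_add) auto
      also have "\<dots> \<le> (\<Sum>i. ennreal (lam (B i)))"
        by (intro suminf_le V B) auto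
      finally show "outer (U \<inter> A) + outer ((UNIV - U) \<inter> A) \<le> (\<Sum>i. ennreal (lam (B i)))" .
    qed
    have "outer A \<le> outer ((U \<inter> A) \<union> ((UNIV - U) \<inter> A))" by (rule outer_mono) auto
    also have "\<dots> \<le> outer (U \<inter> A) + outer ((UNIV - U) \<inter> A)" by (rule outer_subadditive)
    finally show "outer A \<le> outer (U \<inter> A) + outer ((UNIV - U) \<inter> A)" .
  qed
  then show ?thesis by (auto simp: lambda_system_def)
qed

section \<open>The Borel measure induced by a content\<close>

lemma measure_space_outer: "measure_space UNIV (sets borel) outer"
proof -
  interpret P: sigma_algebra UNIV "Pow (UNIV :: 'a set)" by (rule sigma_algebra_Pow)
  have "outer_measure_space (Pow UNIV) outer"
    unfolding outer_measure_space_def positive_def increasing_def countably_subadditive_def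
    using outer_mono outer_countably_subadditive by auto
  from P.caratheodory_lemma[OF this]
  have L: "measure_space UNIV (lambda_system UNIV (Pow UNIV) outer) outer" .
  moreover have "sets borel \<subseteq> lambda_system UNIV (Pow UNIV) outer"
    unfolding borel_def using L open_in_lambda_system
    by (simp add: measure_space_def) (intro sigma_algebra.sigma_sets_subset, auto)
  moreover have "sigma_algebra UNIV (sets (borel :: 'a measure))"
    by (metis sets.sigma_algebra_axioms space_borel)
  ultimately show ?thesis using measure_down by blast
qed

definition outer_borel :: "'a measure" where
  "outer_borel = measure_of UNIV (sets borel) outer"

lemma sets_outer_borel [simp]: "sets outer_borel = sets borel"
  unfolding outer_borel_def
  by (metis sets.sigma_sets_eq sets_measure_of sets.space_closed space_borel)

lemma space_outer_borel [simp]: "space outer_borel = UNIV"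
  by (simp add: outer_borel_def space_measure_of_conv)

lemma emeasure_outer_borel: "A \<in> sets borel \<Longrightarrow> emeasure outer_borel A = outer A"
  using measure_space_outer unfolding outer_borel_def measure_space_def
  by (intro emeasure_measure_of_sigma) auto

end

section \<open>Invariant measures from orbit frequencies\<close>

lemma funpow_mem: "T ` X \<subseteq> X \<Longrightarrow> x \<in> X \<Longrightarrow> (T ^^ i) x \<in> X"
  by (induction i) auto

lemma continuous_on_funpow: "continuous_on X T \<Longrightarrow> T ` X \<subseteq> X \<Longrightarrow> continuous_on X (T ^^ i)"
proof (induction i)
  case (Suc i)
  then have "continuous_on X (T \<circ> (T ^^ i))"
    by (intro continuous_on_compose) (auto intro: continuous_on_subset funpow_mem)
  then show ?case by simp
qed (simp add: id_def)

text \<open>The inequality for a set and for its complement together force equality, both total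
  masses being 1. So invariance of a measure has to be checked in one direction only.\<close>

lemma prob_space_eqI_le:
  assumes "prob_space M" "prob_space N" "sets M = sets N"
    and le: "\<And>A. A \<in> sets N \<Longrightarrow> emeasure M A \<le> emeasure N A"
  shows "M = N"
proof (rule measure_eqI)
  interpret M: prob_space M by fact
  interpret N: prob_space N by fact
  have sp: "space M = space N" using assms(3) by (rule sets_eq_imp_space_eq)
  fix A assume A: "A \<in> sets M"
  then have AN: "A \<in> sets N" using assms(3) by simp
  have "measure M A \<le> measure N A"
    using le[OF AN] by (simp add: M.emeasure_eq_measure N.emeasure_eq_measure)
  moreover have "measure M (space M - A) \<le> measure N (space N - A)"
    using le[of "space N - A"] AN sp by (simp add: M.emeasure_eq_measure N.emeasure_eq_measure)
  ultimately show "emeasure M A = emeasure N A"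
    using M.prob_compl[OF A] N.prob_compl[OF AN]
    by (simp add: M.emeasure_eq_measure N.emeasure_eq_measure)
qed fact

text \<open>Visit frequencies along orbits of growing length cluster at a content \<open>L\<close>
  that is invariant under preimages; its outer measure yields the invariant measure. The set
  \<open>C\<close> keeps its frequency in the limit because it is closed in \<open>X\<close>, hence
  compact.\<close>

theorem krylov_bogoliubov:
  fixes X :: "'a::metric_space set"
  assumes ds: "dynamical_system X T" and C: "closed C" "C \<subseteq> X"
    and freq: "\<And>N. \<exists>M>N. \<exists>z\<in>X. \<delta> * real M \<le> real (card {i. i < M \<and> (T ^^ i) z \<in> C})"
  obtains \<mu> where "invariant_prob X T \<mu>" "ennreal \<delta> \<le> emeasure \<mu> C"
proof -
  have X: "compact X" "continuous_on X T" "T ` X \<subseteq> X" using ds by (auto simp: dynamical_system_def)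
  obtain M z where M: "\<And>N. M N > N" and z: "\<And>N. z N \<in> X"
    and Mz: "\<And>N. \<delta> * real (M N) \<le> real (card {i. i < M N \<and> (T ^^ i) (z N) \<in> C})"
  proof -
    have "\<forall>N. \<exists>M z. N < M \<and> z \<in> X \<and> \<delta> * real M \<le> real (card {i. i < M \<and> (T ^^ i) z \<in> C})"
      using freq by blast
    from choice[OF this] obtain M where
      "\<forall>N. \<exists>z. N < M N \<and> z \<in> X \<and> \<delta> * real (M N) \<le> real (card {i. i < M N \<and> (T ^^ i) z \<in> C})" ..
    from choice[OF this] show ?thesis using that by blast
  qed
  have zX: "(T ^^ i) (z N) \<in> X" for i N using funpow_mem X(3) z by metis
  define f where "f N A = (\<Sum>i<M N. of_bool ((T ^^ i) (z N) \<in> A)) / real (M N)" for N A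
  have Mpos: "real (M N) > 0" for N using M[of N] by simp
  have "f N A \<in> {0..1}" for N A
  proof -
    have "(\<Sum>i<M N. of_bool ((T ^^ i) (z N) \<in> A)) \<le> (\<Sum>i<M N. 1::real)"
      by (intro sum_mono) auto
    then show ?thesis using Mpos[of N] by (auto simp: f_def sum_nonneg)
  qed
  then obtain G L where G: "G \<noteq> bot" "G \<le> sequentially" and L: "\<And>A. ((\<lambda>N. f N A) \<longlongrightarrow> L A) G"
    using pointwise_cluster[of f] by metis
  interpret L: content L
  proof
    show "0 \<le> L A" for A
      using G(1) by (intro tendsto_lowerbound[OF L]) (auto simp: f_def sum_nonneg)
    show "L (A \<union> B) = L A + L B" if "A \<inter> B = {}" for A B
    proof -
      have "of_bool ((T ^^ i) (z N) \<in> A \<union> B)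
          = (of_bool ((T ^^ i) (z N) \<in> A) + of_bool ((T ^^ i) (z N) \<in> B) :: real)" for i N
        using that by auto
      then have "f N (A \<union> B) = f N A + f N B" for N
        by (simp add: f_def add_divide_distrib sum.distrib)
      then show ?thesis
        using tendsto_unique[OF G(1) L[of "A \<union> B"]] tendsto_add[OF L[of A] L[of B]] by auto
    qed
  qed
  \<comment> \<open>The content lives on the whole type but does not see the complement of
    \<open>X\<close>. Thus preimages that are open only relative to \<open>X\<close> can be replaced
    by open sets.\<close>
  have L_Int: "L (A \<inter> X) = L A" for A
  proof -
    have "f N (A \<inter> X) = f N A" for N by (simp add: f_def zX)
    then show ?thesis using tendsto_unique[OF G(1) L[of "A \<inter> X"]] L[of A] by simp
  qed
  have "f N UNIV = 1" for N using Mpos[of N] by (simp add: f_def)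
  then have "L UNIV = 1" using tendsto_unique[OF G(1) L[of UNIV]] by auto
  then have LX: "L X = 1" using L_Int[of UNIV] by simp
  \<comment> \<open>The averages of a set and of its preimage differ by the two end terms of a
    telescoping sum, divided by the length \<open>M N > N\<close>.\<close>
  have LT: "L {x\<in>X. T x \<in> A} = L A" for A
  proof -
    have "\<bar>f N {x\<in>X. T x \<in> A} - f N A\<bar> \<le> 1 / real (Suc N)" for N
    proof -
      let ?b = "\<lambda>i. of_bool ((T ^^ i) (z N) \<in> A) :: real"
      have "f N {x\<in>X. T x \<in> A} - f N A = ((\<Sum>i<M N. ?b (Suc i)) - (\<Sum>i<M N. ?b i)) / real (M N)"
        by (simp add: f_def zX diff_divide_distrib)
      also have "(\<Sum>i<M N. ?b (Suc i)) - (\<Sum>i<M N. ?b i) = ?b (M N) - ?b 0"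
        by (simp only: sum_subtractf[symmetric] sum_lessThan_telescope[of ?b])
      finally have "\<bar>f N {x\<in>X. T x \<in> A} - f N A\<bar> = \<bar>?b (M N) - ?b 0\<bar> / real (M N)"
        by simp
      also have "\<dots> \<le> 1 / real (M N)" by (intro divide_right_mono) auto
      also have "\<dots> \<le> 1 / real (Suc N)" using M[of N] by (intro divide_left_mono) auto
      finally show ?thesis .
    qed
    then have "\<forall>\<^sub>F N in G. norm (f N {x\<in>X. T x \<in> A} - f N A) \<le> 1 / real (Suc N)"
      by (intro always_eventually allI) (simp only: real_norm_def)
    moreover have "((\<lambda>N. 1 / real (Suc N)) \<longlongrightarrow> 0) G"
      by (rule tendsto_mono[OF G(2) LIMSEQ_Suc[OF lim_1_over_n]])
    ultimately have "((\<lambda>N. f N {x\<in>X. T x \<in> A} - f N A) \<longlongrightarrow> 0) G"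
      by (rule Lim_null_comparison)
    moreover have "((\<lambda>N. f N {x\<in>X. T x \<in> A} - f N A) \<longlongrightarrow> L {x\<in>X. T x \<in> A} - L A) G"
      by (intro tendsto_diff L)
    ultimately have "0 = L {x\<in>X. T x \<in> A} - L A" by (rule tendsto_unique[OF G(1)])
    then show ?thesis by simp
  qed
  have "\<delta> \<le> f N C" for N
  proof -
    have "{..<M N} \<inter> {i. (T ^^ i) (z N) \<in> C} = {i. i < M N \<and> (T ^^ i) (z N) \<in> C}" by auto
    then have "f N C = real (card {i. i < M N \<and> (T ^^ i) (z N) \<in> C}) / real (M N)"
      by (simp add: f_def sum_of_bool_eq)
    then show ?thesis using Mz[of N] Mpos[of N] by (simp add: pos_le_divide_eq)
  qed
  then have LC: "\<delta> \<le> L C" using tendsto_lowerbound[OF L[of C], of \<delta>] G(1) by simp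

  define \<mu> where "\<mu> = restrict_space L.outer_borel X"
  have Xb: "X \<in> sets borel" using X(1) by (simp add: compact_imp_closed)
  have sets: "sets \<mu> = sets (restrict_space borel X)"
    by (simp add: \<mu>_def sets_restrict_space)
  have space: "space \<mu> = X" by (simp add: \<mu>_def space_restrict_space)
  have em: "emeasure \<mu> A = L.outer A" if "A \<in> sets \<mu>" for A
    using that Xb unfolding \<mu>_def
    by (auto simp: emeasure_restrict_space sets_restrict_space L.emeasure_outer_borel)
  have prob: "prob_space \<mu>"
  proof
    have "L.outer X \<le> L.outer UNIV" by (rule L.outer_mono) simp
    also have "\<dots> \<le> 1" using L.outer_open_le[of UNIV] \<open>L UNIV = 1\<close> by simp
    finally have "L.outer X = 1" using L.outer_compact_ge[OF X(1)] LX by (intro antisym) auto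
    then show "emeasure \<mu> (space \<mu>) = 1" using em[OF sets.top] space by simp
  qed
  have T: "T \<in> \<mu> \<rightarrow>\<^sub>M \<mu>"
  proof -
    have "T \<in> restrict_space borel X \<rightarrow>\<^sub>M restrict_space borel X"
      using borel_measurable_continuous_on_restrict[OF X(2)] X(3)
      by (intro measurable_restrict_space2) (auto simp: space_restrict_space)
    then show ?thesis using measurable_cong_sets[OF sets sets] by simp
  qed
  \<comment> \<open>Preimages under \<open>T\<close> turn an open cover of \<open>A\<close> into a
    cover of the preimage of \<open>A\<close> with the same contents.\<close>
  have le: "L.outer {x\<in>X. T x \<in> A} \<le> L.outer A" for A
  proof (rule L.outer_greatest)
    fix U :: "nat \<Rightarrow> 'a set" assume U: "\<And>i. open (U i)" "A \<subseteq> (\<Union>i. U i)"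
    have "\<exists>V. open V \<and> {x\<in>X. T x \<in> U i} = V \<inter> X" for i
      using continuous_on_open_invariant[THEN iffD1, OF X(2), rule_format, OF U(1)[of i]]
      by (auto simp: vimage_def Int_def conj_commute)
    then obtain V where V: "\<And>i. open (V i)" "\<And>i. {x\<in>X. T x \<in> U i} = V i \<inter> X" by metis
    have "L.outer {x\<in>X. T x \<in> A} \<le> (\<Sum>i. ennreal (L (V i)))"
      using U(2) V by (intro L.outer_le) blast+
    moreover have "L (V i) = L (U i)" for i using LT[of "U i"] L_Int[of "V i"] V(2)[of i] by simp
    ultimately show "L.outer {x\<in>X. T x \<in> A} \<le> (\<Sum>i. ennreal (L (U i)))" by simp
  qed
  have "distr \<mu> \<mu> T = \<mu>"
  proof (rule prob_space_eqI_le)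
    show "prob_space (distr \<mu> \<mu> T)" using prob T by (rule prob_space.prob_space_distr)
    fix A assume A: "A \<in> sets \<mu>"
    have "T -` A \<inter> space \<mu> = {x\<in>X. T x \<in> A}" using space by auto
    then show "emeasure (distr \<mu> \<mu> T) A \<le> emeasure \<mu> A"
      using T A le[of A] em[OF A] em[OF measurable_sets[OF T A]] by (simp add: emeasure_distr)
  qed (use prob in auto)
  with prob sets T have "invariant_prob X T \<mu>" by (simp add: invariant_prob_def)
  moreover have "ennreal \<delta> \<le> emeasure \<mu> C"
  proof -
    have "C \<in> sets \<mu>" using C Xb by (auto simp: sets sets_restrict_space)
    moreover have "compact C" using C X(1) compact_Int_closed[of X C] by (simp add: Int_absorb1)
    ultimately show ?thesis
      using em[of C] order_trans[OF ennreal_leI[OF LC] L.outer_compact_ge[of C]] by simp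
  qed
  ultimately show ?thesis using that by blast
qed

section \<open>Entropy of covers\<close>

text \<open>Fekete's lemma. \<open>cover_entropy\<close> is written with \<open>lim\<close>, so a
  lower bound along a subsequence says something about it only once convergence is known.\<close>

lemma subadditive_convergent:
  fixes a :: "nat \<Rightarrow> real"
  assumes nonneg: "\<And>n. 0 \<le> a n" and sub: "\<And>m n. a (m + n) \<le> a m + a n"
  shows "convergent (\<lambda>n. a n / real n)"
proof -
  define L where "L = (INF n\<in>{1..}. a n / real n)"
  have bdd: "bdd_below ((\<lambda>n. a n / real n) ` {1..})"
    by (rule bdd_belowI2[of _ 0]) (use nonneg in auto)
  \<comment> \<open>Division with remainder: each full block of length \<open>k\<close> costs
    \<open>a k\<close>, and \<open>C\<close> below bounds the remainder term uniformly.\<close>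
  have mult: "a (q * k + r) \<le> real q * a k + a r" for q k r
  proof (induction q)
    case (Suc q)
    have "a (Suc q * k + r) \<le> a k + a (q * k + r)"
      using sub[of k "q * k + r"] by (simp add: add.assoc)
    with Suc show ?case by (simp add: algebra_simps)
  qed simp
  have "(\<lambda>n. a n / real n) \<longlonglongrightarrow> L"
  proof (rule LIMSEQ_I)
    fix e :: real assume e: "0 < e"
    obtain k where k: "k \<ge> 1" "a k / real k < L + e / 2"
      using cINF_less_iff[OF _ bdd, of "L + e/2"] e unfolding L_def by auto
    define C where "C = (\<Sum>r<k. a r)"
    have C: "a r \<le> C" if "r < k" for r
      unfolding C_def using that nonneg by (intro member_le_sum) auto
    obtain N where N: "real N > 2 * C / e" using reals_Archimedean2 by blast
    show "\<exists>no. \<forall>n\<ge>no. norm (a n / real n - L) < e"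
    proof (intro exI[of _ "N + 1"] allI impI)
      fix n assume n: "N + 1 \<le> n"
      have n0: "0 < real n" using n by simp
      have "L \<le> a n / real n" unfolding L_def using n by (intro cINF_lower[OF bdd]) auto
      moreover have "a n / real n < L + e"
      proof -
        have "a n \<le> real (n div k) * a k + C"
          using mult[of "n div k" k "n mod k"] C[of "n mod k"] k by simp
        also have "real (n div k) \<le> real n / real k"
          by (rule of_nat_div_le_of_nat)
        finally have "a n \<le> real n / real k * a k + C"
          by (simp add: mult_right_mono nonneg)
        then have "a n / real n \<le> (real n / real k * a k + C) / real n"
          using n0 by (intro divide_right_mono) auto
        also have "\<dots> = a k / real k + C / real n" using n0 by (simp add: field_simps)
        also have "C / real n < e / 2"
        proof -
          have "2 * C / e < real n" using N n by linarith
          then show ?thesis using e n0 by (simp add: field_simps)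
        qed
        finally show ?thesis using k(2) by simp
      qed
      ultimately show "norm (a n / real n - L) < e" by (simp add: abs_less_iff)
    qed
  qed
  then show ?thesis by (rule convergentI)
qed

section \<open>Minimal subcovers of iterated joins\<close>

lemma min_subcover_le:
  "\<V> \<subseteq> \<U> \<Longrightarrow> finite \<V> \<Longrightarrow> Y \<subseteq> \<Union>\<V> \<Longrightarrow> min_subcover Y \<U> \<le> card \<V>"
  unfolding min_subcover_def by (rule Least_le) auto

lemma min_subcover_attained:
  assumes "finite \<U>" "Y \<subseteq> \<Union>\<U>"
  obtains \<V> where "\<V> \<subseteq> \<U>" "finite \<V>" "Y \<subseteq> \<Union>\<V>" "card \<V> = min_subcover Y \<U>"
proof -
  have "\<exists>k. \<exists>\<V>\<subseteq>\<U>. finite \<V> \<and> Y \<subseteq> \<Union>\<V> \<and> card \<V> = k"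
    using assms by (intro exI[of _ "card \<U>"] exI[of _ \<U>]) simp
  from LeastI_ex[OF this] show ?thesis using that unfolding min_subcover_def by blast
qed

text \<open>Every \<open>y w\<close> lies in some member of a minimal subcover, and each member
  accounts for at most \<open>b\<close> of the labels \<open>w\<close>. Counting labels instead of
  points takes care of a possible lack of injectivity of \<open>y\<close>.\<close>

lemma card_le_min_subcover:
  assumes "finite \<U>" "Y \<subseteq> \<Union>\<U>" and P: "finite P" "y ` P \<subseteq> Y"
    and b: "\<And>E. E \<in> \<U> \<Longrightarrow> card {w\<in>P. y w \<in> E} \<le> b"
  shows "card P \<le> min_subcover Y \<U> * b"
proof -
  obtain \<V> where \<V>: "\<V> \<subseteq> \<U>" "finite \<V>" "Y \<subseteq> \<Union>\<V>" "card \<V> = min_subcover Y \<U>"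
    using min_subcover_attained assms(1,2) by blast
  have "P = (\<Union>E\<in>\<V>. {w\<in>P. y w \<in> E})" using P(2) \<V>(3) by auto
  then have "card P \<le> (\<Sum>E\<in>\<V>. card {w\<in>P. y w \<in> E})" using card_UN_le[OF \<V>(2)] by metis
  also have "\<dots> \<le> card \<V> * b"
    using sum_bounded_above[of \<V> "\<lambda>E. card {w\<in>P. y w \<in> E}" b] b \<V>(1) by auto
  finally show ?thesis using \<V>(4) by simp
qed

lemma finite_iterated_join:
  assumes "finite \<U>"
  shows "finite (iterated_join Y T n \<U>)"
proof -
  \<comment> \<open>An itinerary \<open>A\<close> is arbitrary from \<open>n\<close> on; restricting
    it to \<open>{..<n}\<close> leaves finitely many.\<close>
  have "iterated_join Y T n \<U> \<subseteq> (\<lambda>A. {x \<in> Y. \<forall>i<n. (T ^^ i) x \<in> A i}) ` ({..<n} \<rightarrow>\<^sub>E \<U>)"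
  proof
    fix E assume "E \<in> iterated_join Y T n \<U>"
    then obtain A where A: "A \<in> {..<n} \<rightarrow> \<U>" "E = {x \<in> Y. \<forall>i<n. (T ^^ i) x \<in> A i}"
      by (auto simp: iterated_join_def)
    then show "E \<in> (\<lambda>A. {x \<in> Y. \<forall>i<n. (T ^^ i) x \<in> A i}) ` ({..<n} \<rightarrow>\<^sub>E \<U>)"
      by (intro image_eqI[of _ _ "restrict A {..<n}"]) auto
  qed
  then show ?thesis using assms by (meson finite_PiE finite_imageI finite_lessThan finite_subset)
qed

lemma iterated_join_covers:
  assumes "Y \<subseteq> \<Union>\<U>" "T ` Y \<subseteq> Y"
  shows "Y \<subseteq> \<Union>(iterated_join Y T n \<U>)"
proof
  fix x assume x: "x \<in> Y"
  have "(T ^^ i) x \<in> Y" for i using x assms(2) by (induction i) auto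
  then have "\<forall>i. \<exists>A. A \<in> \<U> \<and> (T ^^ i) x \<in> A" using assms(1) by blast
  then obtain A where "\<And>i. A i \<in> \<U> \<and> (T ^^ i) x \<in> A i" by metis
  then show "x \<in> \<Union>(iterated_join Y T n \<U>)"
    using x by (auto simp: iterated_join_def intro!: exI[of _ "{x \<in> Y. \<forall>i<n. (T ^^ i) x \<in> A i}"] exI[of _ A])
qed

text \<open>A subcover for the first \<open>m\<close> steps is intersected with the preimage under
  \<open>T ^^ m\<close> of one for the next \<open>n\<close> steps.\<close>

lemma min_subcover_iterated_join_add:
  assumes fin: "finite \<U>" and cov: "Y \<subseteq> \<Union>\<U>" and inv: "T ` Y \<subseteq> Y"
  shows "min_subcover Y (iterated_join Y T (m + n) \<U>)
    \<le> min_subcover Y (iterated_join Y T m \<U>) * min_subcover Y (iterated_join Y T n \<U>)"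
proof -
  note attained = min_subcover_attained[OF finite_iterated_join[OF fin] iterated_join_covers[OF cov inv]]
  obtain \<V> where \<V>: "\<V> \<subseteq> iterated_join Y T m \<U>" "finite \<V>" "Y \<subseteq> \<Union>\<V>"
    "card \<V> = min_subcover Y (iterated_join Y T m \<U>)" by (rule attained)
  obtain \<W> where \<W>: "\<W> \<subseteq> iterated_join Y T n \<U>" "finite \<W>" "Y \<subseteq> \<Union>\<W>"
    "card \<W> = min_subcover Y (iterated_join Y T n \<U>)" by (rule attained)
  define h where "h = (\<lambda>(V, W). {x\<in>V. (T ^^ m) x \<in> W})"
  have TY: "(T ^^ i) x \<in> Y" if "x \<in> Y" for x i using that inv by (induction i) auto
  have "h ` (\<V> \<times> \<W>) \<subseteq> iterated_join Y T (m + n) \<U>"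
  proof
    fix E assume "E \<in> h ` (\<V> \<times> \<W>)"
    then obtain V W where "V \<in> \<V>" "W \<in> \<W>" and E: "E = {x\<in>V. (T ^^ m) x \<in> W}" by (auto simp: h_def)
    then have "V \<in> iterated_join Y T m \<U>" "W \<in> iterated_join Y T n \<U>" using \<V>(1) \<W>(1) by auto
    then obtain A B where A: "A \<in> {..<m} \<rightarrow> \<U>" "V = {x \<in> Y. \<forall>i<m. (T ^^ i) x \<in> A i}"
      and B: "B \<in> {..<n} \<rightarrow> \<U>" "W = {x \<in> Y. \<forall>i<n. (T ^^ i) x \<in> B i}"
      by (auto simp: iterated_join_def)
    define D where "D i = (if i < m then A i else B (i - m))" for i
    have "D \<in> {..<m + n} \<rightarrow> \<U>" using A(1) B(1) by (auto simp: D_def Pi_iff)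
    moreover have "E = {x \<in> Y. \<forall>i<m + n. (T ^^ i) x \<in> D i}"
    proof (rule set_eqI)
      fix x
      have "(\<forall>i<m + n. (T ^^ i) x \<in> D i) \<longleftrightarrow>
          (\<forall>i<m. (T ^^ i) x \<in> A i) \<and> (\<forall>i<n. (T ^^ (i + m)) x \<in> B i)"
        proof (intro iffI conjI allI impI)
        fix i assume D: "\<forall>i<m + n. (T ^^ i) x \<in> D i"
        show "(T ^^ i) x \<in> A i" if "i < m" using D[rule_format, of i] that by (simp add: D_def)
        show "(T ^^ (i + m)) x \<in> B i" if "i < n"
          using D[rule_format, of "i + m"] that by (simp add: D_def)
      next
        fix i assume AB: "(\<forall>i<m. (T ^^ i) x \<in> A i) \<and> (\<forall>i<n. (T ^^ (i + m)) x \<in> B i)" and "i < m + n"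
        then show "(T ^^ i) x \<in> D i"
        proof (cases "i < m")
          case False
          then have "i - m < n" "i = i - m + m" using \<open>i < m + n\<close> by auto
          then show ?thesis using AB False unfolding D_def by metis
        qed (simp add: D_def)
      qed
      then show "x \<in> E \<longleftrightarrow> x \<in> {x \<in> Y. \<forall>i<m + n. (T ^^ i) x \<in> D i}"
        using TY[of x m] by (auto simp: E A(2) B(2) funpow_add)
    qed
    ultimately show "E \<in> iterated_join Y T (m + n) \<U>"
      unfolding iterated_join_def mem_Collect_eq by (intro exI[of _ D] conjI)
  qed
  moreover have "Y \<subseteq> \<Union>(h ` (\<V> \<times> \<W>))"
  proof
    fix x assume x: "x \<in> Y"
    obtain V where "V \<in> \<V>" "x \<in> V" using x \<V>(3) by auto
    moreover obtain W where "W \<in> \<W>" "(T ^^ m) x \<in> W" using TY[OF x] \<W>(3) by blast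
    ultimately show "x \<in> \<Union>(h ` (\<V> \<times> \<W>))" by (force simp: h_def)
  qed
  ultimately have "min_subcover Y (iterated_join Y T (m + n) \<U>) \<le> card (h ` (\<V> \<times> \<W>))"
    using \<V>(2) \<W>(2) by (intro min_subcover_le) auto
  also have "\<dots> \<le> card \<V> * card \<W>"
    using card_image_le[of "\<V> \<times> \<W>" h] \<V>(2) \<W>(2) by (simp add: card_cartesian_product)
  finally show ?thesis using \<V>(4) \<W>(4) by simp
qed

text \<open>The growth hypothesis, multiplied out to stay within the natural numbers, says that the
  covering numbers at times \<open>m * n\<close> are at least \<open>(k / (k - 1)) ^ m\<close>. This
  is an exponential rate of \<open>ln (k / (k - 1)) / n\<close> along a subsequence.\<close>

lemma cover_entropy_pos:
  assumes fin: "finite \<U>" and cov: "Y \<subseteq> \<Union>\<U>" and inv: "T ` Y \<subseteq> Y" and ne: "Y \<noteq> {}"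
    and n: "1 \<le> n" and k: "2 \<le> k"
    and growth: "\<And>m. k ^ m \<le> min_subcover Y (iterated_join Y T (m * n) \<U>) * (k - 1) ^ m"
  shows "0 < cover_entropy Y T \<U>"
proof -
  define N where "N n = min_subcover Y (iterated_join Y T n \<U>)" for n
  have N1: "1 \<le> N i" for i
  proof -
    obtain \<V> where \<V>: "finite \<V>" "Y \<subseteq> \<Union>\<V>" "card \<V> = N i" unfolding N_def
      by (rule min_subcover_attained[OF finite_iterated_join[OF fin] iterated_join_covers[OF cov inv]])
    then have "\<V> \<noteq> {}" using ne by auto
    then show ?thesis using \<V> by (metis One_nat_def Suc_leI card_gt_0_iff)
  qed
  have "convergent (\<lambda>i. ln (real (N i)) / real i)"
  proof (rule subadditive_convergent)
    show "0 \<le> ln (real (N i))" for i using N1[of i] by simp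
    fix i j
    have "real (N (i + j)) \<le> real (N i) * real (N j)"
      using min_subcover_iterated_join_add[OF fin cov inv, of i j] unfolding N_def
      by (metis of_nat_le_iff of_nat_mult)
    moreover have "0 < real (N i)" "0 < real (N j)" "0 < real (N (i + j))"
      using N1[of i] N1[of j] N1[of "i + j"] by auto
    ultimately show "ln (real (N (i + j))) \<le> ln (real (N i)) + ln (real (N j))"
      by (metis ln_mult_pos ln_le_cancel_iff mult_pos_pos)
  qed
  then have lim: "(\<lambda>i. ln (real (N i)) / real i) \<longlonglongrightarrow> cover_entropy Y T \<U>"
    unfolding cover_entropy_def N_def by (simp add: convergent_LIMSEQ_iff)
  define c where "c = ln (real k / real (k - 1)) / real n"
  have "0 < c" unfolding c_def using k n by (intro divide_pos_pos ln_gt_zero) auto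
  have "strict_mono (\<lambda>m. m * n)" using n by (auto simp: strict_mono_def)
  from LIMSEQ_subseq_LIMSEQ[OF lim this]
  have "(\<lambda>m. ln (real (N (m * n))) / real (m * n)) \<longlonglongrightarrow> cover_entropy Y T \<U>" by (simp add: o_def)
  moreover have "c \<le> ln (real (N (m * n))) / real (m * n)" if "m \<ge> 1" for m
  proof -
    have "real k ^ m \<le> real (N (m * n)) * real (k - 1) ^ m"
      using growth[of m] unfolding N_def by (metis of_nat_le_iff of_nat_mult of_nat_power)
    then have "(real k / real (k - 1)) ^ m \<le> real (N (m * n))"
      using k by (simp add: power_divide divide_le_eq)
    then have "ln ((real k / real (k - 1)) ^ m) \<le> ln (real (N (m * n)))"
      using k N1[of "m * n"] by (subst ln_le_cancel_iff) auto
    then have "real m * ln (real k / real (k - 1)) \<le> ln (real (N (m * n)))"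
      using k by (subst (asm) ln_realpow) auto
    then show ?thesis using that n unfolding c_def by (simp add: field_simps)
  qed
  ultimately have "c \<le> cover_entropy Y T \<U>" by (intro LIMSEQ_le_const) auto
  with \<open>0 < c\<close> show ?thesis by simp
qed

section \<open>The measure center and almost specification\<close>

lemma measure_center_subset: "measure_center X T \<subseteq> X"
  by (auto simp: measure_center_def)

lemma openin_invariant_prob_sets:
  "invariant_prob X T \<mu> \<Longrightarrow> openin (top_of_set X) U \<Longrightarrow> U \<in> sets \<mu>"
  by (auto simp: invariant_prob_def openin_open sets_restrict_space)

lemma invariant_prob_space: "invariant_prob X T \<mu> \<Longrightarrow> space \<mu> = X"
  using sets_eq_imp_space_eq[of \<mu> "restrict_space borel X"]
  by (auto simp: invariant_prob_def space_restrict_space)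

lemma emeasure_funpow_preimage:
  assumes "invariant_prob X T \<mu>" "W \<in> sets \<mu>"
  shows "{x\<in>X. (T ^^ i) x \<in> W} \<in> sets \<mu> \<and> emeasure \<mu> {x\<in>X. (T ^^ i) x \<in> W} = emeasure \<mu> W"
proof (induction i)
  case 0
  have "{x\<in>X. x \<in> W} = W"
    using sets.sets_into_space[OF assms(2)] invariant_prob_space[OF assms(1)] by auto
  then show ?case using assms(2) by simp
next
  case (Suc i)
  let ?E = "{x\<in>X. (T ^^ i) x \<in> W}"
  have T: "T \<in> \<mu> \<rightarrow>\<^sub>M \<mu>" and d: "distr \<mu> \<mu> T = \<mu>"
    using assms(1) by (auto simp: invariant_prob_def)
  have sp: "space \<mu> = X" by (rule invariant_prob_space[OF assms(1)])
  have "T -` ?E \<inter> space \<mu> = {x\<in>X. (T ^^ Suc i) x \<in> W}"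
    using measurable_space[OF T] sp by (auto simp: funpow_swap1)
  then show ?case
    using Suc measurable_sets[OF T, of ?E] emeasure_distr[OF T, of ?E] d by simp
qed

text \<open>The preimage of a universally null open set is again open and universally null, because
  invariant measures give both the same mass.\<close>

lemma measure_center_invariant:
  assumes ds: "dynamical_system X T"
  shows "T ` measure_center X T \<subseteq> measure_center X T"
proof
  fix y assume "y \<in> T ` measure_center X T"
  then obtain x where x: "x \<in> measure_center X T" and y: "y = T x" by blast
  have X: "continuous_on X T" "T ` X \<subseteq> X" using ds by (auto simp: dynamical_system_def)
  have xX: "x \<in> X" using x measure_center_subset by blast
  show "y \<in> measure_center X T"
  proof (rule ccontr)
    assume "y \<notin> measure_center X T"
    then obtain U where U: "openin (top_of_set X) U" "universally_null X T U" "T x \<in> U"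
      using X(2) xX y by (auto simp: measure_center_def)
    have op: "openin (top_of_set X) {x\<in>X. T x \<in> U}"
      using continuous_openin_preimage[OF X(1) _ U(1)] X(2) by (auto simp: vimage_def Int_def)
    have "emeasure \<mu> {x\<in>X. T x \<in> U} = 0" if \<mu>: "invariant_prob X T \<mu>" for \<mu>
      using emeasure_funpow_preimage[OF \<mu> openin_invariant_prob_sets[OF \<mu> U(1)], of 1] U(2) \<mu>
      by (simp add: universally_null_def)
    then have "x \<notin> measure_center X T"
      using op U(3) xX unfolding measure_center_def universally_null_def by auto
    then show False using x by contradiction
  qed
qed

text \<open>Otherwise, by compactness, finitely many universally null open sets would cover
  \<open>C\<close>, and \<open>C\<close> would have measure 0.\<close>

lemma compact_meets_measure_center:
  assumes C: "compact C" "C \<subseteq> X" and \<mu>: "invariant_prob X T \<mu>" "0 < emeasure \<mu> C"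
  shows "C \<inter> measure_center X T \<noteq> {}"
proof
  assume "C \<inter> measure_center X T = {}"
  then have "C \<subseteq> \<Union>{U. openin (top_of_set X) U \<and> universally_null X T U}"
    using C(2) by (auto simp: measure_center_def)
  moreover have "compactin (top_of_set X) C"
    using C by (simp add: compactin_subtopology)
  ultimately obtain \<F> where \<F>: "finite \<F>" "\<F> \<subseteq> {U. openin (top_of_set X) U \<and> universally_null X T U}"
    "C \<subseteq> \<Union>\<F>"
    unfolding compactin_def by (metis (no_types, lifting) mem_Collect_eq)
  have "U \<in> null_sets \<mu>" if "U \<in> \<F>" for U
    using that \<F>(2) \<mu>(1) openin_invariant_prob_sets[OF \<mu>(1), of U]
    by (auto simp: universally_null_def)
  then have "(\<Union>U\<in>\<F>. U) \<in> null_sets \<mu>"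
    using \<F>(1) by (intro null_sets_UN') (auto intro: countable_finite)
  then have "\<Union>\<F> \<in> sets \<mu>" "emeasure \<mu> (\<Union>\<F>) = 0" by auto
  then show False using emeasure_mono[OF \<F>(3), of \<mu>] \<mu>(2) by simp
qed

lemma center_ball_charged:
  assumes "p \<in> measure_center X T" "0 < r"
  obtains \<mu> where "invariant_prob X T \<mu>" "0 < emeasure \<mu> (X \<inter> ball p r)"
proof -
  have "openin (top_of_set X) (X \<inter> ball p r)" by (auto simp: openin_open)
  then have "\<not> universally_null X T (X \<inter> ball p r)"
    using assms unfolding measure_center_def by force
  then obtain \<mu> where "invariant_prob X T \<mu>" "emeasure \<mu> (X \<inter> ball p r) \<noteq> 0"
    unfolding universally_null_def by auto
  then show ?thesis using that by (simp add: zero_less_iff_neq_zero)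
qed

text \<open>By invariance the number of visits to \<open>W\<close> at times in \<open>S\<close> has
  expectation \<open>measure \<mu> W * card S\<close>, and some point attains at least the mean.
  Arbitrary finite sets \<open>S\<close>, not only intervals, let a further point be chosen along
  the visiting times of earlier ones.\<close>

lemma exists_frequent_visits:
  assumes \<mu>: "invariant_prob X T \<mu>" and W: "W \<in> sets \<mu>" and S: "finite S"
  obtains x where "x \<in> X" "measure \<mu> W * real (card S) \<le> real (card {i\<in>S. (T ^^ i) x \<in> W})"
proof -
  interpret prob_space \<mu> using \<mu> by (simp add: invariant_prob_def)
  have sp: "space \<mu> = X" by (rule invariant_prob_space[OF \<mu>])
  let ?E = "\<lambda>i. {x\<in>X. (T ^^ i) x \<in> W}"
  let ?f = "\<lambda>x. \<Sum>i\<in>S. indicat_real (?E i) x"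
  note E = emeasure_funpow_preimage[OF \<mu> W]
  have int: "integrable \<mu> (indicat_real (?E i))" for i
    using E[of i] by (simp add: emeasure_eq_measure)
  have "expectation ?f = (\<Sum>i\<in>S. measure \<mu> (?E i))"
    using E by (subst Bochner_Integration.integral_sum) (auto intro: int)
  also have "\<dots> = measure \<mu> W * real (card S)"
    using E by (simp add: measure_def)
  finally have ex: "expectation ?f = measure \<mu> W * real (card S)" .
  have "\<exists>x\<in>X. measure \<mu> W * real (card S) \<le> ?f x"
  proof (rule ccontr)
    assume "\<not> ?thesis"
    then have "\<forall>x\<in>space \<mu>. ?f x < measure \<mu> W * real (card S)" using sp by (auto simp: not_le)
    then have "expectation ?f < measure \<mu> W * real (card S)"
      by (intro expectation_less) (auto intro: int)
    then show False using ex by simp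
  qed
  then obtain x where x: "x \<in> X" "measure \<mu> W * real (card S) \<le> ?f x" by blast
  have "?f x = (\<Sum>i\<in>S. of_bool ((T ^^ i) x \<in> W))"
    using x(1) by (intro sum.cong) (auto simp: indicator_def)
  also have "\<dots> = real (card {i\<in>S. (T ^^ i) x \<in> W})"
    using S by (simp add: sum_of_bool_eq Int_def)
  finally show ?thesis using that x by simp
qed

text \<open>Choosing the points one after the other, each among the visiting times of the previous
  ones, replaces an invariant measure on the product system.\<close>

lemma common_visits:
  fixes X :: "'a::metric_space set"
  assumes "finite F" "F \<subseteq> measure_center X T" "0 < r"
  shows "\<exists>c>0. \<forall>n. \<exists>S x. S \<subseteq> {..<n} \<and> c * real n \<le> real (card S) \<and>
    (\<forall>p\<in>F. x p \<in> X \<and> (\<forall>i\<in>S. dist p ((T ^^ i) (x p)) < r))"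
  using assms(1,2)
proof (induction F rule: finite_induct)
  case empty
  have "\<exists>S. S \<subseteq> {..<n} \<and> real n \<le> real (card S)" for n :: nat
    by (intro exI[of _ "{..<n}"]) auto
  then show ?case by (intro exI[of _ 1]) simp
next
  case (insert q F)
  then obtain c where c: "0 < c" and IH: "\<And>n. \<exists>S x. S \<subseteq> {..<n} \<and> c * real n \<le> real (card S) \<and>
    (\<forall>p\<in>F. x p \<in> X \<and> (\<forall>i\<in>S. dist p ((T ^^ i) (x p)) < r))" by auto
  obtain \<mu> where \<mu>: "invariant_prob X T \<mu>" "0 < emeasure \<mu> (X \<inter> ball q r)"
    using center_ball_charged[of q X T r] insert.prems assms(3) by auto
  let ?W = "X \<inter> ball q r"
  interpret prob_space \<mu> using \<mu>(1) by (simp add: invariant_prob_def)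
  have W: "?W \<in> sets \<mu>"
    by (intro openin_invariant_prob_sets[OF \<mu>(1)]) (auto simp: openin_open)
  have pos: "0 < measure \<mu> ?W" using \<mu>(2) by (simp add: emeasure_eq_measure)
  show ?case
  \<comment> \<open>Each new point costs a factor: of the times \<open>S\<close> found so far, a
    share of at least \<open>measure \<mu> ?W\<close> is kept.\<close>
  proof (intro exI[of _ "measure \<mu> ?W * c"] conjI allI)
    show "0 < measure \<mu> ?W * c" using pos c by simp
    fix n
    obtain S x where S: "S \<subseteq> {..<n}" "c * real n \<le> real (card S)"
      and x: "\<And>p. p \<in> F \<Longrightarrow> x p \<in> X \<and> (\<forall>i\<in>S. dist p ((T ^^ i) (x p)) < r)"
      using IH[of n] by blast
    obtain y where y: "y \<in> X"
      "measure \<mu> ?W * real (card S) \<le> real (card {i\<in>S. (T ^^ i) y \<in> ?W})"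
      using exists_frequent_visits[OF \<mu>(1) W, of S] finite_subset[OF S(1)] by auto
    have "measure \<mu> ?W * c * real n \<le> measure \<mu> ?W * real (card S)"
      using S(2) pos by (simp add: mult.assoc)
    then show "\<exists>S x. S \<subseteq> {..<n} \<and> measure \<mu> ?W * c * real n \<le> real (card S) \<and>
        (\<forall>p\<in>insert q F. x p \<in> X \<and> (\<forall>i\<in>S. dist p ((T ^^ i) (x p)) < r))"
      using S(1) x y insert.hyps(2)
      by (intro exI[of _ "{i\<in>S. (T ^^ i) y \<in> ?W}"] exI[of _ "x(q := y)"])
        (auto simp: intro: order_trans)
  qed
qed

section \<open>Blocks that follow prescribed orbit segments\<close>

lemma closed_mistake_ball:
  assumes "dynamical_system X T"
  shows "closed (mistake_ball X T g n x \<epsilon>)"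
proof -
  have X: "compact X" "continuous_on X T" "T ` X \<subseteq> X"
    using assms by (auto simp: dynamical_system_def)
  have 1: "closed {y\<in>X. dist ((T ^^ i) x) ((T ^^ i) y) \<le> \<epsilon>}" for i
  proof -
    have "continuous_on X (\<lambda>y. dist ((T ^^ i) x) ((T ^^ i) y))"
      by (intro continuous_intros continuous_on_funpow X)
    then have "closed (X \<inter> (\<lambda>y. dist ((T ^^ i) x) ((T ^^ i) y)) -` {..\<epsilon>})"
      by (intro continuous_closed_preimage compact_imp_closed[OF X(1)]) auto
    then show ?thesis by (simp add: vimage_def Int_def)
  qed
  \<comment> \<open>A union of closed sets, finite since there are only finitely many sets
    \<open>\<Lambda>\<close> in \<open>{..<n}\<close>.\<close>
  have "mistake_ball X T g n x \<epsilon> = (\<Union>\<Lambda>\<in>{\<Lambda>. \<Lambda> \<subseteq> {..<n} \<and> card ({..<n} - \<Lambda>) \<le> g n \<epsilon>}.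
      X \<inter> (\<Inter>i\<in>\<Lambda>. {y\<in>X. dist ((T ^^ i) x) ((T ^^ i) y) \<le> \<epsilon>}))"
    unfolding mistake_ball_def by blast
  also have "closed \<dots>"
    by (intro closed_UN ballI closed_Int closed_INT 1 compact_imp_closed[OF X(1)]) auto
  finally show ?thesis .
qed

text \<open>A point following a long repetition of a finite block pattern returns to the set of points
  following the pattern with positive frequency, so an invariant measure charges that set.\<close>

lemma follow_in_measure_center:
  assumes ds: "dynamical_system X T" and n: "1 \<le> (n::nat)"
    and B: "\<And>p. p \<in> F \<Longrightarrow> closed (B p) \<and> B p \<subseteq> X"
    and follow: "\<And>w m. (\<And>j. w j \<in> F) \<Longrightarrow> \<exists>z\<in>X. \<forall>j<m. (T ^^ (j * n)) z \<in> B (w j)"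
    and w: "\<And>j. w j \<in> F"
  shows "\<exists>y\<in>measure_center X T. \<forall>j<m. (T ^^ (j * n)) y \<in> B (w j)"
proof -
  have X: "compact X" "continuous_on X T" "T ` X \<subseteq> X" using ds by (auto simp: dynamical_system_def)
  \<comment> \<open>One letter more than asked for makes the period positive even for
    \<open>m = 0\<close>.\<close>
  define k where "k = Suc m"
  have kn: "0 < k * n" using n by (simp add: k_def)
  define C where "C = X \<inter> (\<Inter>j\<in>{..<k}. X \<inter> (T ^^ (j * n)) -` B (w j))"
  have "closed (X \<inter> (T ^^ (j * n)) -` B (w j))" for j
    using X B[OF w]
    by (intro continuous_closed_preimage continuous_on_funpow compact_imp_closed[OF X(1)]) auto
  then have "closed (\<Inter>j\<in>{..<k}. X \<inter> (T ^^ (j * n)) -` B (w j))" by (intro closed_INT ballI)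
  then have C: "closed C" "C \<subseteq> X"
    unfolding C_def using compact_imp_closed[OF X(1)] by (blast intro: closed_Int)+
  have "\<exists>M>N. \<exists>z\<in>X. (1 / real (k * n)) * real M \<le> real (card {i. i < M \<and> (T ^^ i) z \<in> C})" for N
  proof -
    \<comment> \<open>\<open>M\<close> spans \<open>Suc N\<close> periods of length
      \<open>k * n\<close>. The orbit is in \<open>C\<close> at the start of each period, hence with
      frequency at least \<open>1 / (k * n)\<close>.\<close>
    define M where "M = Suc N * (k * n)"
    obtain z where z: "z \<in> X" "\<And>j. j < Suc N * k \<Longrightarrow> (T ^^ (j * n)) z \<in> B (w (j mod k))"
      using follow[of "\<lambda>j. w (j mod k)" "Suc N * k"] w by blast
    have "(T ^^ (l * (k * n))) z \<in> C" if l: "l < Suc N" for l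
    proof -
      have "(T ^^ (j * n)) ((T ^^ (l * (k * n))) z) \<in> B (w j)" if j: "j < k" for j
      proof -
        have "j + l * k < Suc l * k" using j by simp
        also have "\<dots> \<le> Suc N * k" using l by (intro mult_le_mono1) simp
        finally have "(T ^^ ((j + l * k) * n)) z \<in> B (w ((j + l * k) mod k))" by (rule z(2))
        moreover have "(j + l * k) * n = j * n + l * (k * n)" by (simp add: algebra_simps)
        ultimately show ?thesis using j by (simp add: funpow_add)
      qed
      then show ?thesis using funpow_mem[OF X(3) z(1)] by (simp add: C_def)
    qed
    moreover have "l * (k * n) < M" if "l < Suc N" for l
      unfolding M_def using that kn by (rule mult_strict_right_mono)
    ultimately have "(\<lambda>l. l * (k * n)) ` {..<Suc N} \<subseteq> {i. i < M \<and> (T ^^ i) z \<in> C}" by auto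
    moreover have "inj_on (\<lambda>l. l * (k * n)) {..<Suc N}" using kn by (auto simp: inj_on_def)
    moreover have "finite {i. i < M \<and> (T ^^ i) z \<in> C}" by simp
    ultimately have "Suc N \<le> card {i. i < M \<and> (T ^^ i) z \<in> C}"
      using card_inj_on_le[of "\<lambda>l. l * (k * n)" "{..<Suc N}"] by simp
    moreover have "(1 / real (k * n)) * real M = real (Suc N)"
      unfolding M_def of_nat_mult[of "Suc N"] using kn by (simp del: of_nat_mult of_nat_Suc)
    ultimately have "(1 / real (k * n)) * real M \<le> real (card {i. i < M \<and> (T ^^ i) z \<in> C})"
      by (simp only: of_nat_le_iff)
    moreover have "N < M"
    proof -
      have "Suc N * 1 \<le> M" unfolding M_def using kn by (intro mult_le_mono2) simp
      then show ?thesis by simp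
    qed
    ultimately show ?thesis using z(1) by blast
  qed
  from krylov_bogoliubov[OF ds C this] obtain \<mu> where
    \<mu>: "invariant_prob X T \<mu>" "ennreal (1 / real (k * n)) \<le> emeasure \<mu> C" .
  have "0 < real (k * n)" using kn by (simp only: of_nat_0_less_iff)
  then have "0 < ennreal (1 / real (k * n))" by simp
  then have "0 < emeasure \<mu> C" using \<mu>(2) by (rule less_le_trans)
  moreover have "compact C" using C X(1) compact_Int_closed[of X C] by (simp add: Int_absorb1)
  ultimately obtain y where "y \<in> C" "y \<in> measure_center X T"
    using compact_meets_measure_center[OF _ C(2) \<mu>(1)] by blast
  have "(T ^^ (j * n)) y \<in> B (w j)" if "j < m" for j
    using \<open>y \<in> C\<close> less_SucI[OF that] unfolding C_def k_def Int_iff INT_iff by blast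
  with \<open>y \<in> measure_center X T\<close> show ?thesis by blast
qed

text \<open>Specializes the property to a single \<open>\<epsilon>\<close> and to adjacent blocks of
  common length \<open>n\<close>.\<close>

lemma almost_specification_blocks:
  assumes "almost_specification X T"
  obtains \<epsilon>\<^sub>0 g where "mistake_function \<epsilon>\<^sub>0 g"
    "\<And>\<epsilon> n x m. 0 < \<epsilon> \<Longrightarrow> \<epsilon> < \<epsilon>\<^sub>0 \<Longrightarrow> 1 \<le> n \<Longrightarrow> mistake_threshold g \<epsilon> \<le> n \<Longrightarrow> (\<And>j. x j \<in> X) \<Longrightarrow>
      \<exists>z\<in>X. \<forall>j<m. (T ^^ (j * n)) z \<in> mistake_ball X T g n (x j) \<epsilon>"
proof -
  obtain \<epsilon>\<^sub>0 g where g: "mistake_function \<epsilon>\<^sub>0 g" and sp: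
    "\<forall>m (\<epsilon> :: nat \<Rightarrow> real) (x :: nat \<Rightarrow> 'a) (a :: nat \<Rightarrow> nat) (b :: nat \<Rightarrow> nat).
           1 \<le> m \<and>
           (\<forall>j\<in>{1..m}. 0 < \<epsilon> j \<and> \<epsilon> j < \<epsilon>\<^sub>0 \<and> x j \<in> X \<and> a j \<le> b j \<and>
                       mistake_threshold g (\<epsilon> j) \<le> b j - a j + 1) \<and>
           (\<forall>j\<in>{1..<m}. b j < a (j + 1))
           \<longrightarrow> (\<exists>z\<in>X. \<forall>j\<in>{1..m}.
                  (T ^^ a j) z \<in> mistake_ball X T g (b j - a j + 1) (x j) (\<epsilon> j))"
    using assms unfolding almost_specification_def by (elim exE conjE) (rule that)
  have "\<exists>z\<in>X. \<forall>j<m. (T ^^ (j * n)) z \<in> mistake_ball X T g n (x j) \<epsilon>"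
    if *: "0 < \<epsilon>" "\<epsilon> < \<epsilon>\<^sub>0" "1 \<le> n" "mistake_threshold g \<epsilon> \<le> n" "\<And>j. x j \<in> X" for \<epsilon> n x m
  proof -
    \<comment> \<open>The specification is indexed from 1, the words from 0. It is applied to
      \<open>Suc m\<close> blocks, so that there is at least one block even for
      \<open>m = 0\<close>.\<close>
    define a where "a j = (j - 1) * n" for j
    define b where "b j = a j + (n - 1)" for j
    have len: "b j - a j + 1 = n" for j using *(3) by (simp add: b_def)
    have "b j < a (j + 1)" if "1 \<le> j" for j
      using that *(3) by (cases j) (auto simp: a_def b_def)
    then obtain z where z: "z \<in> X"
      "\<And>j. j \<in> {1..Suc m} \<Longrightarrow> (T ^^ a j) z \<in> mistake_ball X T g n (x (j - 1)) \<epsilon>"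
      using sp[THEN spec[of _ "Suc m"], THEN spec[of _ "\<lambda>_. \<epsilon>"], THEN spec[of _ "\<lambda>j. x (j - 1)"],
          THEN spec[of _ a], THEN spec[of _ b]] *
      unfolding len by (auto simp: b_def)
    have "(T ^^ (j * n)) z \<in> mistake_ball X T g n (x j) \<epsilon>" if "j < m" for j
      using z(2)[of "Suc j"] that by (simp add: a_def)
    with z(1) show ?thesis by blast
  qed
  with g show ?thesis using that by blast
qed

text \<open>The number of mistakes is \<open>o(n)\<close>, whereas the common visiting times \<open>S\<close> have density
  bounded from below.\<close>

lemma exists_coding_blocks:
  fixes X :: "'a::metric_space set" and k :: nat
  assumes ds: "dynamical_system X T" and spec: "almost_specification X T"
    and F: "finite F" "F \<subseteq> measure_center X T" and r: "0 < r"
  obtains n S B where "1 \<le> n" "S \<subseteq> {..<n}"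
    "\<forall>p\<in>F. closed (B p) \<and> B p \<subseteq> X"
    "\<forall>p\<in>F. \<forall>y\<in>B p. k * card {i\<in>S. r \<le> dist p ((T ^^ i) y)} < card S"
    "\<forall>w m. (\<forall>j. w j \<in> F) \<longrightarrow> (\<exists>z\<in>X. \<forall>j<m. (T ^^ (j * n)) z \<in> B (w j))"
proof -
  obtain \<epsilon>\<^sub>0 g where g: "mistake_function \<epsilon>\<^sub>0 g" and blocks:
    "\<And>\<epsilon> n x m. 0 < \<epsilon> \<Longrightarrow> \<epsilon> < \<epsilon>\<^sub>0 \<Longrightarrow> 1 \<le> n \<Longrightarrow> mistake_threshold g \<epsilon> \<le> n \<Longrightarrow> (\<And>j. x j \<in> X) \<Longrightarrow>
      \<exists>z\<in>X. \<forall>j<m. (T ^^ (j * n)) z \<in> mistake_ball X T g n (x j) \<epsilon>"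
    using almost_specification_blocks[OF spec] by metis
  have \<epsilon>\<^sub>0: "0 < \<epsilon>\<^sub>0" using g by (simp add: mistake_function_def)
  \<comment> \<open>Half of \<open>r\<close> is spent on the mistake ball and half on the visits of
    \<open>x p\<close>: at the times in \<open>S\<close> without a mistake, a point of
    \<open>B p\<close> is closer than \<open>r\<close> to \<open>p\<close>.\<close>
  define \<epsilon> where "\<epsilon> = min (\<epsilon>\<^sub>0 / 2) (r / 2)"
  have \<epsilon>: "0 < \<epsilon>" "\<epsilon> < \<epsilon>\<^sub>0" "\<epsilon> \<le> r / 2" using \<epsilon>\<^sub>0 r by (auto simp: \<epsilon>_def)
  have lim: "(\<lambda>n. real (g n \<epsilon>) / real n) \<longlonglongrightarrow> 0" using g \<epsilon> by (simp add: mistake_function_def)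
  obtain c where c: "0 < c" and cv: "\<And>n. \<exists>S x. S \<subseteq> {..<n} \<and> c * real n \<le> real (card S) \<and>
    (\<forall>p\<in>F. x p \<in> X \<and> (\<forall>i\<in>S. dist p ((T ^^ i) (x p)) < r / 2))"
    using common_visits[OF F, of "r / 2"] r by auto
  \<comment> \<open>The divisor \<open>k + 1\<close> is positive for every \<open>k\<close> and
    leads to \<open>k * g n \<epsilon> < card S\<close>.\<close>
  have "eventually (\<lambda>n. real (g n \<epsilon>) / real n < c / (real k + 1)) sequentially"
    using c by (intro order_tendstoD(2)[OF lim]) auto
  then obtain N where N: "\<And>n. N \<le> n \<Longrightarrow> real (g n \<epsilon>) / real n < c / (real k + 1)"
    by (auto simp: eventually_sequentially)
  define n where "n = Suc (max N (mistake_threshold g \<epsilon>))"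
  have n: "1 \<le> n" "mistake_threshold g \<epsilon> \<le> n" "N \<le> n" by (auto simp: n_def)
  obtain S x where S: "S \<subseteq> {..<n}" "c * real n \<le> real (card S)"
    and x: "\<And>p. p \<in> F \<Longrightarrow> x p \<in> X" "\<And>p i. p \<in> F \<Longrightarrow> i \<in> S \<Longrightarrow> dist p ((T ^^ i) (x p)) < r / 2"
    using cv[of n] by blast
  have kg: "k * g n \<epsilon> < card S"
  proof -
    have "0 < c * real n" using c n by simp
    moreover have "(real k + 1) * real (g n \<epsilon>) < c * real n"
      using N[OF n(3)] n(1) by (simp add: divide_less_eq pos_less_divide_eq mult.commute)
    ultimately have "real k * real (g n \<epsilon>) < real (card S)"
      using S(2) by (simp add: distrib_right)
    then show ?thesis by (metis of_nat_less_iff of_nat_mult)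
  qed
  define B where "B p = mistake_ball X T g n (x p) \<epsilon>" for p
  show ?thesis
  proof (rule that[OF n(1) S(1)]; intro ballI allI impI)
    show "closed (B p) \<and> B p \<subseteq> X" for p
      using closed_mistake_ball[OF ds] by (auto simp: B_def mistake_ball_def)
    show "k * card {i\<in>S. r \<le> dist p ((T ^^ i) y)} < card S" if p: "p \<in> F" and y: "y \<in> B p" for p y
    proof -
      obtain \<Lambda> where \<Lambda>: "card ({..<n} - \<Lambda>) \<le> g n \<epsilon>"
        "\<And>i. i \<in> \<Lambda> \<Longrightarrow> dist ((T ^^ i) (x p)) ((T ^^ i) y) \<le> \<epsilon>"
        using y by (auto simp: B_def mistake_ball_def)
      have "{i\<in>S. r \<le> dist p ((T ^^ i) y)} \<subseteq> {..<n} - \<Lambda>"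
      proof
        fix i assume i: "i \<in> {i\<in>S. r \<le> dist p ((T ^^ i) y)}"
        have "i \<notin> \<Lambda>"
        proof
          assume "i \<in> \<Lambda>"
          then show False
            using \<Lambda>(2)[of i] x(2)[OF p, of i] i \<epsilon>(3)
              dist_triangle[of p "(T ^^ i) y" "(T ^^ i) (x p)"] by simp
        qed
        then show "i \<in> {..<n} - \<Lambda>" using i S(1) by auto
      qed
      then have "card {i\<in>S. r \<le> dist p ((T ^^ i) y)} \<le> g n \<epsilon>"
        using \<Lambda>(1) by (meson card_mono finite_Diff finite_lessThan order_trans)
      then show ?thesis using kg by (meson le_less_trans mult_le_mono2)
    qed
    show "\<exists>z\<in>X. \<forall>j<m. (T ^^ (j * n)) z \<in> B (w j)" if "\<forall>j. w j \<in> F" for w m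
      unfolding B_def using blocks[OF \<epsilon>(1,2) n(1,2), of "\<lambda>j. x (w j)"] x(1) that by blast
  qed
qed

section \<open>Entropy tuples and horseshoes\<close>

theorem measure_center_topological_K:
  assumes ds: "dynamical_system X T" and spec: "almost_specification X T"
  shows "topological_K (measure_center X T) T"
  unfolding topological_K_def entropy_tuple_def
proof (intro allI impI conjI; (elim conjE)?)
  fix xs :: "'a list" and U :: "'a \<Rightarrow> 'a set"
  define Y where "Y = measure_center X T"
  define F where "F = set xs"
  define \<U> where "\<U> = (\<lambda>p. Y - U p) ` F"
  define k where "k = card F"
  assume "set xs \<subseteq> measure_center X T" and nd: "nondiagonal xs"
    and U1: "\<forall>p\<in>set xs. closedin (top_of_set (measure_center X T)) (U p) \<and>
      p \<in> top_of_set (measure_center X T) interior_of U p"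
    and disj: "\<forall>p\<in>set xs. \<forall>q\<in>set xs. p \<noteq> q \<longrightarrow> U p \<inter> U q = {}"
  then have F: "finite F" "F \<subseteq> Y" by (auto simp: F_def Y_def)
  obtain p q where pq: "p \<in> F" "q \<in> F" "p \<noteq> q" using nd by (auto simp: nondiagonal_def F_def)
  have k: "2 \<le> k"
    unfolding k_def using card_mono[OF F(1), of "{p, q}"] pq by simp
  have inv: "T ` Y \<subseteq> Y" unfolding Y_def by (rule measure_center_invariant[OF ds])
  \<comment> \<open>Two different entries have disjoint neighborhoods, so no point of
    \<open>Y\<close> lies in all the sets \<open>U s\<close>.\<close>
  have cov: "Y \<subseteq> \<Union>\<U>" using disj pq by (auto simp: \<U>_def F_def)
  have "\<exists>e>0. Y \<inter> ball s e \<subseteq> U s" if "s \<in> F" for s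
  proof -
    have "s \<in> top_of_set Y interior_of U s" using U1 that by (simp add: F_def Y_def)
    then obtain V where "open V" "s \<in> V" "Y \<inter> V \<subseteq> U s"
      by (auto simp: interior_of_def openin_open)
    then show ?thesis by (meson Int_mono open_contains_ball order_refl order_trans)
  qed
  then obtain e where e: "\<And>s. s \<in> F \<Longrightarrow> 0 < e s" "\<And>s. s \<in> F \<Longrightarrow> Y \<inter> ball s (e s) \<subseteq> U s" by metis
  \<comment> \<open>A common radius for all entries: points of \<open>Y\<close> outside
    \<open>U s\<close> have distance at least \<open>r\<close> from \<open>s\<close>.\<close>
  define r where "r = Min (e ` F)"
  have "0 < r" unfolding r_def using F(1) pq(1) e(1) by (subst Min_gr_iff) auto
  have rU: "z \<in> U s" if "s \<in> F" "z \<in> Y" "dist s z < r" for s z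
  proof -
    have "r \<le> e s" unfolding r_def using F(1) that(1) by simp
    then show ?thesis using e(2)[OF that(1)] that by auto
  qed
  obtain n S B where n: "1 \<le> n" and S: "S \<subseteq> {..<n}"
    and B: "\<forall>p\<in>F. closed (B p) \<and> B p \<subseteq> X"
    and few: "\<forall>p\<in>F. \<forall>y\<in>B p. k * card {i\<in>S. r \<le> dist p ((T ^^ i) y)} < card S"
    and follow: "\<forall>w m. (\<forall>j. w j \<in> F) \<longrightarrow> (\<exists>z\<in>X. \<forall>j<m. (T ^^ (j * n)) z \<in> B (w j))"
    by (rule exists_coding_blocks[OF ds spec F[unfolded Y_def] \<open>0 < r\<close>, where k = k])
  have finS: "finite S" using S finite_subset by blast
  have "k ^ m \<le> min_subcover Y (iterated_join Y T (m * n) \<U>) * (k - 1) ^ m" for m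
  proof -
    define P where "P = {..<m} \<rightarrow>\<^sub>E F"
    have "\<exists>y\<in>Y. \<forall>j<m. (T ^^ (j * n)) y \<in> B (w j)" if "w \<in> P" for w
    proof -
      \<comment> \<open>Words in \<open>P\<close> are undefined from \<open>m\<close> on;
        \<open>p\<close> serves as filler letter there.\<close>
      have wF: "(if j < m then w j else p) \<in> F" for j using that pq(1) by (auto simp: P_def)
      show ?thesis
        using follow_in_measure_center[OF ds n, of F B "\<lambda>j. if j < m then w j else p" m]
          B follow wF by (simp add: Y_def)
    qed
    then obtain y where y: "\<And>w. w \<in> P \<Longrightarrow> y w \<in> Y"
      "\<And>w j. w \<in> P \<Longrightarrow> j < m \<Longrightarrow> (T ^^ (j * n)) (y w) \<in> B (w j)" by metis
    have "card {w\<in>P. y w \<in> E} \<le> (k - 1) ^ m" if E: "E \<in> iterated_join Y T (m * n) \<U>" for E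
    proof -
      obtain A where A: "A \<in> {..<m * n} \<rightarrow> \<U>" "E = {x \<in> Y. \<forall>i<m * n. (T ^^ i) x \<in> A i}"
        using E by (auto simp: iterated_join_def)
      have "\<forall>i\<in>{..<m * n}. \<exists>s\<in>F. A i = Y - U s" using A(1) by (auto simp: \<U>_def)
      then obtain a where a: "\<And>i. i < m * n \<Longrightarrow> a i \<in> F" "\<And>i. i < m * n \<Longrightarrow> A i = Y - U (a i)"
        by (metis lessThan_iff)
      have lt: "j * n + i < m * n" if "j < m" "i \<in> S" for i j
      proof -
        have "j * n + i < Suc j * n" using that(2) S by auto
        also have "\<dots> \<le> m * n" using that(1) by (intro mult_le_mono1) simp
        finally show ?thesis .
      qed
      \<comment> \<open>Pigeonhole: the \<open>k\<close> letters share the times in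
        \<open>S\<close>, so one of them gets at least \<open>card S / k\<close>.\<close>
      have "\<exists>s\<in>F. card S \<le> k * card {i\<in>S. a (j * n + i) = s}" if j: "j < m" for j
      proof (rule ccontr)
        assume "\<not> ?thesis"
        then have less: "k * card {i\<in>S. a (j * n + i) = s} < card S" if "s \<in> F" for s
          using that by auto
        have "S = (\<Union>s\<in>F. {i\<in>S. a (j * n + i) = s})" using a(1) lt[OF j] by auto
        then have "card S \<le> (\<Sum>s\<in>F. card {i\<in>S. a (j * n + i) = s})"
          using card_UN_le[OF F(1)] by metis
        then have "k * card S \<le> (\<Sum>s\<in>F. k * card {i\<in>S. a (j * n + i) = s})"
          by (simp add: sum_distrib_left[symmetric])
        also have "\<dots> < (\<Sum>s\<in>F. card S)"
          using F(1) pq(1) less by (intro sum_strict_mono) auto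
        finally show False by (simp add: k_def)
      qed
      then obtain q where q: "\<And>j. j < m \<Longrightarrow> q j \<in> F"
        "\<And>j. j < m \<Longrightarrow> card S \<le> k * card {i\<in>S. a (j * n + i) = q j}" by metis
      have "{w\<in>P. y w \<in> E} \<subseteq> (\<Pi>\<^sub>E j\<in>{..<m}. F - {q j})"
      proof
        fix w assume w: "w \<in> {w\<in>P. y w \<in> E}"
        have "w j \<noteq> q j" if j: "j < m" for j
        proof
          assume eq: "w j = q j"
          let ?z = "(T ^^ (j * n)) (y w)"
          \<comment> \<open>At these times the orbit avoids \<open>U (q j)\<close> and hence has
            distance at least \<open>r\<close> from \<open>q j\<close>. There are at least
            \<open>card S / k\<close> of them, whereas \<open>few\<close> allows fewer for a point
            of \<open>B (q j)\<close>.\<close>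
          have "{i\<in>S. a (j * n + i) = q j} \<subseteq> {i\<in>S. r \<le> dist (q j) ((T ^^ i) ?z)}"
          proof
            fix i assume i: "i \<in> {i\<in>S. a (j * n + i) = q j}"
            have "(T ^^ (j * n + i)) (y w) \<in> Y - U (q j)"
              using w i A(2) a(2)[OF lt[OF j]] lt[OF j, of i] by auto
            moreover have "(T ^^ (j * n + i)) (y w) = (T ^^ i) ?z"
              by (simp add: funpow_add add.commute[of "j * n"])
            ultimately show "i \<in> {i\<in>S. r \<le> dist (q j) ((T ^^ i) ?z)}"
              using rU[OF q(1)[OF j], of "(T ^^ i) ?z"] i by force
          qed
          then have "card {i\<in>S. a (j * n + i) = q j} \<le> card {i\<in>S. r \<le> dist (q j) ((T ^^ i) ?z)}"
            using finS by (intro card_mono) auto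
          then have "card S \<le> k * card {i\<in>S. r \<le> dist (q j) ((T ^^ i) ?z)}"
            using q(2)[OF j] by (meson mult_le_mono2 order_trans)
          moreover have "?z \<in> B (q j)" using y(2)[of w j] w j eq by simp
          ultimately show False using few q(1)[OF j] by (meson not_le)
        qed
        then show "w \<in> (\<Pi>\<^sub>E j\<in>{..<m}. F - {q j})" using w by (auto simp: P_def PiE_iff)
      qed
      then have "card {w\<in>P. y w \<in> E} \<le> card (\<Pi>\<^sub>E j\<in>{..<m}. F - {q j})"
        using F(1) by (intro card_mono finite_PiE) auto
      also have "\<dots> = (\<Prod>j<m. card (F - {q j}))" by (simp add: card_PiE)
      also have "\<dots> = (\<Prod>j<m. k - 1)"
        by (intro prod.cong) (use q(1) F(1) in \<open>auto simp: k_def\<close>)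
      finally show ?thesis by simp
    qed
    moreover have "finite P" "card P = k ^ m"
      using F(1) by (auto simp: P_def k_def card_PiE finite_PiE)
    moreover have "finite (iterated_join Y T (m * n) \<U>)"
      using F(1) by (intro finite_iterated_join) (simp add: \<U>_def)
    moreover have "y ` P \<subseteq> Y" using y(1) by auto
    ultimately show ?thesis
      using card_le_min_subcover[of "iterated_join Y T (m * n) \<U>" Y P y "(k - 1) ^ m"]
        iterated_join_covers[OF cov inv] by simp
  qed
  then have "0 < cover_entropy Y T \<U>"
    using F pq(1) cov inv n k by (intro cover_entropy_pos[of \<U> Y T n k]) (auto simp: \<U>_def)
  then show "0 < cover_entropy (measure_center X T) T ((\<lambda>p. measure_center X T - U p) ` set xs)"
    by (simp add: \<U>_def Y_def F_def)
qed auto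

text \<open>Since \<open>B 0\<close> and \<open>B 1\<close> are closed and disjoint, each coordinate
  of the itinerary splits \<open>Z\<close> into two relatively clopen pieces, hence continuity.
  Surjectivity is a compactness argument: infinite words are realized because all finite ones
  are.\<close>

theorem horseshoe_of_disjoint_blocks:
  assumes ds: "dynamical_system X T" and n: "1 \<le> (n::nat)"
    and B: "\<And>b. b \<in> {0, 1::nat} \<Longrightarrow> closed (B b) \<and> B b \<subseteq> X" and disj: "B 0 \<inter> B 1 = {}"
    and follow: "\<And>w m. (\<And>j. w j \<in> {0, 1}) \<Longrightarrow> \<exists>z\<in>X. \<forall>j<m. (T ^^ (j * n)) z \<in> B (w j)"
  shows "has_horseshoe X T"
proof -
  have X: "compact X" "continuous_on X T" "T ` X \<subseteq> X" using ds by (auto simp: dynamical_system_def)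
  define Q where "Q j C = X \<inter> (T ^^ (j * n)) -` C" for j C
  have clQ: "closed (Q j C)" if "closed C" for j C
    unfolding Q_def using X that
    by (intro continuous_closed_preimage continuous_on_funpow compact_imp_closed[OF X(1)]) auto
  define Z where "Z = X \<inter> (\<Inter>j. Q j (B 0 \<union> B 1))"
  \<comment> \<open>On \<open>Z\<close> the default value 1 means exactly that the point is in
    \<open>B 1\<close> at time \<open>j * n\<close>.\<close>
  define \<phi> where "\<phi> z j = (if (T ^^ (j * n)) z \<in> B 0 then 0 else 1::nat)" for z j
  have clB: "closed (B 0)" "closed (B 1)" using B by auto
  have clZ: "closed Z"
    unfolding Z_def using clB by (intro closed_Int closed_INT compact_imp_closed[OF X(1)] clQ ballI closed_Un)
  have shift: "(T ^^ (j * n)) ((T ^^ n) z) = (T ^^ (Suc j * n)) z" for j z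
    by (simp add: add.commute[of n] funpow_add)
  have "closedin (top_of_set X) Z" using clZ by (auto simp: closedin_closed Z_def)
  moreover have "(T ^^ n) ` Z \<subseteq> Z"
  proof
    fix x assume "x \<in> (T ^^ n) ` Z"
    then obtain z where z: "z \<in> Z" "x = (T ^^ n) z" by blast
    then have "x \<in> X" using funpow_mem[OF X(3)] by (auto simp: Z_def)
    moreover have "(T ^^ (j * n)) x \<in> B 0 \<union> B 1" for j
      using z(1) unfolding z(2) shift Z_def Q_def by blast
    ultimately show "x \<in> Z" by (simp add: Z_def Q_def)
  qed
  moreover have "factor_map (top_of_set Z) (T ^^ n) (full_shift {0, 1}) shift \<phi>"
    unfolding factor_map_def
  proof (intro conjI ballI)
    have "continuous_map (top_of_set Z) (discrete_topology {0, 1}) (\<lambda>z. \<phi> z j)" for j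
    proof -
      have "closed {z\<in>Z. \<phi> z j \<in> C}" for C
      proof -
        have "{z\<in>Z. \<phi> z j \<in> C} = Z \<inter> Q j ((if 0 \<in> C then B 0 else {}) \<union> (if 1 \<in> C then B 1 else {}))"
          using disj by (auto simp: Z_def \<phi>_def Q_def)
        moreover have "closed ((if 0 \<in> C then B 0 else {}) \<union> (if 1 \<in> C then B 1 else {}))"
          using clB by auto
        ultimately show ?thesis using closed_Int[OF clZ clQ] by metis
      qed
      then have "closedin (top_of_set Z) {z\<in>Z. \<phi> z j \<in> C}" for C
        by (intro closed_subset) auto
      then show ?thesis by (auto simp: continuous_map_closedin \<phi>_def)
    qed
    then show "continuous_map (top_of_set Z) (full_shift {0, 1}) \<phi>"
      unfolding full_shift_def by (simp add: continuous_map_componentwise_UNIV)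
    show "\<phi> ` topspace (top_of_set Z) = topspace (full_shift {0, 1})"
    proof
      show "\<phi> ` topspace (top_of_set Z) \<subseteq> topspace (full_shift {0, 1})"
        by (auto simp: full_shift_def \<phi>_def)
      show "topspace (full_shift {0, 1}) \<subseteq> \<phi> ` topspace (top_of_set Z)"
      proof
        fix w assume "w \<in> topspace (full_shift {0, 1::nat})"
        then have w: "w j \<in> {0, 1}" for j by (auto simp: full_shift_def PiE_iff)
        \<comment> \<open>Finitely many coordinates lie below some \<open>m\<close>, so
          \<open>follow\<close> provides the finite intersection property.\<close>
        have "X \<inter> (\<Inter>j\<in>UNIV. Q j (B (w j))) \<noteq> {}"
        proof (rule compact_imp_fip_image[OF X(1)])
          show "closed (Q j (B (w j)))" for j using B[OF w] clQ by blast
          fix J :: "nat set" assume "finite J"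
          then obtain m where m: "\<And>j. j \<in> J \<Longrightarrow> j < m" by (auto simp: finite_nat_set_iff_bounded)
          obtain z where "z \<in> X" "\<forall>j<m. (T ^^ (j * n)) z \<in> B (w j)"
            using follow[where w = w and m = m, OF w] by (rule bexE)
          then have "z \<in> X \<inter> (\<Inter>j\<in>J. Q j (B (w j)))" using m by (auto simp: Q_def)
          then show "X \<inter> (\<Inter>j\<in>J. Q j (B (w j))) \<noteq> {}" by blast
        qed
        then obtain z where z: "z \<in> X" "\<And>j. (T ^^ (j * n)) z \<in> B (w j)" by (auto simp: Q_def)
        have "\<phi> z j = w j" for j using z(2)[of j] w[of j] disj by (auto simp: \<phi>_def)
        moreover have "z \<in> Z"
        proof -
          have "(T ^^ (j * n)) z \<in> B 0 \<union> B 1" for j using z(2)[of j] w[of j] by auto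
          then show ?thesis using z(1) by (simp add: Z_def Q_def)
        qed
        ultimately show "w \<in> \<phi> ` topspace (top_of_set Z)" by (intro image_eqI[of _ _ z]) auto
      qed
    qed
    show "\<phi> ((T ^^ n) x) = shift (\<phi> x)" for x
      by (rule ext) (simp only: \<phi>_def shift_def shift)
  qed
  ultimately show ?thesis
    unfolding has_horseshoe_def using n
    by (intro exI[of _ n] conjI exI[of _ Z] exI[of _ "{0, 1}"] exI[of _ \<phi>]) auto
qed

theorem horseshoe_of_almost_specification:
  assumes ds: "dynamical_system X T" and spec: "almost_specification X T"
    and pq: "p \<in> measure_center X T" "q \<in> measure_center X T" "p \<noteq> q"
  shows "has_horseshoe X T"
proof -
  \<comment> \<open>No point is closer than half the distance to both \<open>p\<close> and
    \<open>q\<close>. At every time in \<open>S\<close> a common point of \<open>B p\<close> and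
    \<open>B q\<close> would thus be far from one of them, but with \<open>k = 2\<close> each case
    covers less than half of \<open>S\<close>.\<close>
  define r where "r = dist p q / 2"
  have "0 < r" using pq(3) by (simp add: r_def)
  obtain n S B where n: "1 \<le> n" and S: "S \<subseteq> {..<n}"
    and B: "\<forall>s\<in>{p, q}. closed (B s) \<and> B s \<subseteq> X"
    and few: "\<forall>s\<in>{p, q}. \<forall>y\<in>B s. 2 * card {i\<in>S. r \<le> dist s ((T ^^ i) y)} < card S"
    and follow: "\<forall>w m. (\<forall>j. w j \<in> {p, q}) \<longrightarrow> (\<exists>z\<in>X. \<forall>j<m. (T ^^ (j * n)) z \<in> B (w j))"
    by (rule exists_coding_blocks[OF ds spec _ _ \<open>0 < r\<close>, where F = "{p, q}" and k = 2]) (use pq in auto)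
  have finS: "finite S" using S finite_subset by blast
  have disj: "B p \<inter> B q = {}"
  proof (rule ccontr)
    assume "B p \<inter> B q \<noteq> {}"
    then obtain y where y: "y \<in> B p" "y \<in> B q" by blast
    have "S \<subseteq> {i\<in>S. r \<le> dist p ((T ^^ i) y)} \<union> {i\<in>S. r \<le> dist q ((T ^^ i) y)}"
    proof
      fix i assume "i \<in> S"
      then show "i \<in> {i\<in>S. r \<le> dist p ((T ^^ i) y)} \<union> {i\<in>S. r \<le> dist q ((T ^^ i) y)}"
        using dist_triangle2[of p q "(T ^^ i) y"] by (auto simp: r_def)
    qed
    then have "card S \<le> card ({i\<in>S. r \<le> dist p ((T ^^ i) y)} \<union> {i\<in>S. r \<le> dist q ((T ^^ i) y)})"
      using finS by (intro card_mono) auto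
    also have "\<dots> \<le> card {i\<in>S. r \<le> dist p ((T ^^ i) y)} + card {i\<in>S. r \<le> dist q ((T ^^ i) y)}"
      by (rule card_Un_le)
    finally show False using few y by fastforce
  qed
  define b where "b i = (if i = 0 then p else q)" for i :: nat
  have b: "b i \<in> {p, q}" for i by (simp add: b_def)
  show ?thesis
  proof (rule horseshoe_of_disjoint_blocks[OF ds n, of "\<lambda>i. B (b i)"])
    show "closed (B (b i)) \<and> B (b i) \<subseteq> X" for i using B b[of i] by blast
    show "B (b 0) \<inter> B (b 1) = {}" using disj by (simp add: b_def)
    show "\<exists>z\<in>X. \<forall>j<m. (T ^^ (j * n)) z \<in> B (b (w j))" for w m using follow b by simp
  qed
qed

theorem theorem21:
  fixes X :: "'a::metric_space set" and T :: "'a \<Rightarrow> 'a"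
  assumes "dynamical_system X T"
    and "almost_specification X T"
  shows "topological_K (measure_center X T) T \<and>
    ((\<exists>p\<in>measure_center X T. \<exists>q\<in>measure_center X T. p \<noteq> q) \<longrightarrow> has_horseshoe X T)"
  using measure_center_topological_K[OF assms] horseshoe_of_almost_specification[OF assms] by blast

end
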